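(* Let $T:\mathcal J(T)\to\mathcal J(T)$ be a random critically finite map. If $b_T<+\infty$, then $\mathcal E\mathrm P_\infty(b_T)=0$ and (consequently) $D_T=[0,b_T]$.
   Context: Random critically finite maps. Let $I=[0,1]$ and let $\mathcal G$ be a finite collection of closed subintervals of $I$ with pairwise disjoint interiors such that $0$ and $1$ belong to two different elements of $\mathcal G$, denoted $\Delta_0\ni 0$ and $\Delta_1\ni 1$. Put $I_*=\bigcup_{\Delta\in\mathcal G}\Delta$. Let $\mathcal G=\mathcal G_C\cup\mathcal G_E$ be a disjoint union, let $\kappa>1$, $A>1$, and let $\gamma:\mathcal G_C\to\{1,2,\dots\}$, $\Delta\mapsto\gamma_\Delta$. $\mathcal M(\mathcal G;\kappa,A,\gamma)$ is the set of continuous maps $f:I_*\to I$ such that (derivatives at endpoints of the intervals of $\mathcal G$ being one-sided, within the interval considered): (M1) for every $\Delta\in\mathcal G$, $f|_\Delta$ is $C^3$, injective, $f(\Delta)=I$, and the Schwarzian derivative $S(f|_\Delta)=\frac{f'''}{f'}-\frac32\left(\frac{f''}{f'}\right)^2$ is negative; (M2) $|f'(x)|\ge\kappa$ for all $x\in\Delta$, $\Delta\in\mathcal G_E$; (M3) for every $\Delta\in\mathcal G_C$ there is a unique $c_\Delta\in\Delta$, in fact $c_\Delta\in\partial\Delta$, with $f'(c_\Delta)=0$; (M4) $f(c_\Delta)\in\{0,1\}$ for all $\Delta\in\mathcal G_C$, and $f(1)=0$; (M5) $f(0)=0$, $f'(0)\ge\kappa$, $f'(1)\le-\kappa$, $\|f'\|_\infty\le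 A$, and there is $s\in(0,1)$ such that $(f|_{\Delta_0})^{-1}(\max\{|\Delta_0|,|\Delta_1|\})\le s$ and $|f'(x)|\ge\kappa$ for all $x\in[0,s]\cup[1-s,1]$; (M6) for every $\Delta\in\mathcal G_C$ there is a $C^3$ function $A_\Delta:\Delta\to[1/A,A]\cup[-A,-1/A]$ with $|A_\Delta'(x)|\in[1/A,A]$ and $f(x)=f(c_\Delta)+A_\Delta(x)(x-c_\Delta)^{1+\gamma_\Delta}$ for all $x\in\Delta$. The points $c_\Delta$ and values $f(c_\Delta)$ do not depend on $f$ in the class. It is assumed that (M7) there is $\Delta\in\mathcal G_C$ with $f(c_\Delta)=0$. Let $(\Omega,\mathcal F,m)$ be a complete probability space, $\theta:\Omega\to\Omega$ an invertible (bimeasurable) $m$-preserving ergodic map, and $\Omega\ni\omega\mapsto T_\omega\in\mathcal M(\mathcal G;\kappa,A,\gamma)$ measurable, i.e. $\omega\mapsto T_\omega(x)$ is measurable for every $x\in I_*$. Put $T_{\omega,\Delta}^{-1}=(T_\omega|_\Delta)^{-1}:I\to\Delta$ and $T_\omega^n=T_{\theta^{n-1}(\omega)}\circ\cdots\circ T_\omega$ where defined. Let $\mathcal J_\omega(T)=\{x\in I:T^n_\omega(x)\in I_*\ \forall n\ge0\}$, so $T_\omega(\mathcal J_\omega(T))=\mathcal J_{\theta(\omega)}(T)$, $\mathcal J(T)=\bigcup_{\omega}\{\omega\}\times\mathcal J_\omega(T)$, and $T:\mathcal J(T)\to\mathcal J(T)$, $T(\omega,x)=(\theta(\omega),T_\omega(x))$.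 This $T$ is called a random critically finite map. Truncated systems, pressure and $b_T$. For $k\ge1$ let $T_{\omega,0}^{-k}=T_{\omega,\Delta_0}^{-1}\circ T_{\theta(\omega),\Delta_0}^{-1}\circ\cdots\circ T_{\theta^{k-1}(\omega),\Delta_0}^{-1}$, $U_\omega(k)=[T_{\omega,0}^{-k}(1),1]$, and $\mathcal J^{(k)}_\omega(T)=\bigcap_{n\ge0}T_\omega^{-n}(I_*\cap U_{\theta^n(\omega)}(k))$, a nonempty closed set with $T_\omega(\mathcal J^{(k)}_\omega(T))\subset\mathcal J^{(k)}_{\theta(\omega)}(T)$. For $t\ge0$ let $\mathcal L_{t,k,\omega}g(x)=\sum_{y\in\mathcal J^{(k)}_\omega(T),\,T_\omega(y)=x}g(y)|T_\omega'(y)|^{-t}$, an operator $C(\mathcal J^{(k)}_\omega(T))\to C(\mathcal J^{(k)}_{\theta(\omega)}(T))$. There exist a random probability measure $\nu_{t,k}$ (a probability measure on $\Omega\times I$ with marginal $m$ on $\Omega$ and disintegration $(\nu_{t,k,\omega})_\omega$) supported on $\bigcup_\omega\{\omega\}\times\mathcal J_\omega^{(k)}(T)$ and a measurable $\lambda_{t,k}:\Omega\to(0,\infty)$ with $\mathcal L_{t,k,\omega}^*\nu_{t,k,\theta(\omega)}=\lambda_{t,k,\omega}\nu_{t,k,\omega}$ for $m$-a.e. $\omega$. Put $\mathcal E\mathrm P_k(t)=\int_\Omega\log\lambda_{t,k,\omega}\,dm(\omega)$ (independent of the choice of $\nu_{t,k}$) and $\mathcal E\mathrm P_\infty(t)=\lim_{k\to\infty}\mathcal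 E\mathrm P_k(t)$ (the limit exists, the sequence being nondecreasing). The set $D_T=\{t\ge0:\mathcal E\mathrm P_\infty(t)\ge0\}$ is an interval of the form $[0,b_T)$ or $[0,b_T]$; this defines $b_T\in[0,\infty]$. *)

theory Defs
  imports "HOL-Probability.Probability"
begin

section \<open>One-sided calculus on closed intervals\<close>

text \<open>Derivative relative to \<^term>\<open>S\<close>; on a nondegenerate compact interval it is the ordinary
  derivative in the interior and the one-sided derivative at the endpoints.\<close>

definition deriv_on :: "real set \<Rightarrow> (real \<Rightarrow> real) \<Rightarrow> real \<Rightarrow> real" where
  "deriv_on S f x = vector_derivative f (at x within S)"

definition Cn_on :: "nat \<Rightarrow> real set \<Rightarrow> (real \<Rightarrow> real) \<Rightarrow> bool" where
  "Cn_on n S f \<longleftrightarrow>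
     (\<forall>j<n. (deriv_on S ^^ j) f differentiable_on S) \<and> continuous_on S ((deriv_on S ^^ n) f)"

definition schwarzian_on :: "real set \<Rightarrow> (real \<Rightarrow> real) \<Rightarrow> real \<Rightarrow> real" where
  "schwarzian_on S f x =
     (deriv_on S ^^ 3) f x / deriv_on S f x
     - 3 / 2 * ((deriv_on S ^^ 2) f x / deriv_on S f x)\<^sup>2"


section \<open>Critically finite maps\<close>

text \<open>\<^term>\<open>GC\<close> and \<^term>\<open>GE\<close> partition the collection of intervals, \<^term>\<open>D0\<close> and \<^term>\<open>D1\<close> are
  the elements containing 0 and 1.\<close>

definition interval_system ::
  "real set set \<Rightarrow> real set set \<Rightarrow> real set \<Rightarrow> real set \<Rightarrow> bool" where
  "interval_system GC GE D0 D1 \<longleftrightarrow>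
     finite (GC \<union> GE) \<and> GC \<inter> GE = {} \<and>
     (\<forall>D\<in>GC \<union> GE. \<exists>a b. 0 \<le> a \<and> a < b \<and> b \<le> 1 \<and> D = {a..b}) \<and>
     (\<forall>D\<in>GC \<union> GE. \<forall>E\<in>GC \<union> GE. D \<noteq> E \<longrightarrow> interior D \<inter> interior E = {}) \<and>
     D0 \<in> GC \<union> GE \<and> D1 \<in> GC \<union> GE \<and> D0 \<noteq> D1 \<and> 0 \<in> D0 \<and> 1 \<in> D1"

text \<open>The class of maps. Since the critical points and critical values are the same for all maps of
  a class, they are parameters \<^term>\<open>c\<close>, \<^term>\<open>v\<close> (relevant on \<^term>\<open>GC\<close> only). Maps are total functions
  of which only the restriction to the union of the intervals matters. The Schwarzian
  derivative makes sense off the critical points only, and the expansion near 0 and 1 concerns the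
  points of the domain of \<^term>\<open>f\<close>. Here \<^term>\<open>s\<close> and \<^term>\<open>a\<close> may depend on \<^term>\<open>f\<close>.\<close>

definition crit_finite_class ::
  "real set set \<Rightarrow> real set set \<Rightarrow> real set \<Rightarrow> real set \<Rightarrow> real \<Rightarrow> real \<Rightarrow> (real set \<Rightarrow> nat) \<Rightarrow>
   (real set \<Rightarrow> real) \<Rightarrow> (real set \<Rightarrow> real) \<Rightarrow> (real \<Rightarrow> real) set" where
  "crit_finite_class GC GE D0 D1 \<kappa> A \<gamma> c v = {f.
     continuous_on (\<Union>(GC \<union> GE)) f \<and> f ` \<Union>(GC \<union> GE) \<subseteq> {0..1} \<and>
     (\<forall>D\<in>GC \<union> GE. Cn_on 3 D f \<and> inj_on f D \<and> f ` D = {0..1} \<and>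
        (\<forall>x\<in>D. deriv_on D f x \<noteq> 0 \<longrightarrow> schwarzian_on D f x < 0)) \<and>
     (\<forall>D\<in>GE. \<forall>x\<in>D. \<kappa> \<le> \<bar>deriv_on D f x\<bar>) \<and>
     (\<forall>D\<in>GC. c D \<in> frontier D \<and> (\<forall>x\<in>D. deriv_on D f x = 0 \<longleftrightarrow> x = c D)) \<and>
     (\<forall>D\<in>GC. f (c D) = v D \<and> v D \<in> {0, 1}) \<and> f 1 = 0 \<and>
     f 0 = 0 \<and> \<kappa> \<le> deriv_on D0 f 0 \<and> deriv_on D1 f 1 \<le> - \<kappa> \<and>
     (\<forall>D\<in>GC \<union> GE. \<forall>x\<in>D. \<bar>deriv_on D f x\<bar> \<le> A) \<and>
     (\<exists>s. 0 < s \<and> s < 1 \<and>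
        inv_into D0 f (max (measure lborel D0) (measure lborel D1)) \<le> s \<and>
        (\<forall>D\<in>GC \<union> GE. \<forall>x\<in>D \<inter> ({0..s} \<union> {1 - s..1}). \<kappa> \<le> \<bar>deriv_on D f x\<bar>)) \<and>
     (\<forall>D\<in>GC. \<exists>a. Cn_on 3 D a \<and>
        (\<forall>x\<in>D. a x \<in> {1 / A..A} \<union> {- A..- (1 / A)} \<and>
               \<bar>deriv_on D a x\<bar> \<in> {1 / A..A} \<and>
               f x = f (c D) + a x * (x - c D) ^ (1 + \<gamma> D)))}"


section \<open>Random critically finite maps\<close>

definition ergodic_automorphism :: "'w measure \<Rightarrow> ('w \<Rightarrow> 'w) \<Rightarrow> bool" where
  "ergodic_automorphism M \<theta> \<longleftrightarrow>
     bij_betw \<theta> (space M) (space M) \<and>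
     \<theta> \<in> measurable M M \<and> inv_into (space M) \<theta> \<in> measurable M M \<and>
     distr M M \<theta> = M \<and>
     (\<forall>B\<in>sets M. \<theta> -` B \<inter> space M = B \<longrightarrow> measure M B = 0 \<or> measure M B = 1)"

text \<open>The skew product \<open>(\<omega>, x) \<mapsto> (\<theta> \<omega>, T \<omega> x)\<close> is given by its data \<^term>\<open>M\<close>, \<^term>\<open>\<theta>\<close>, \<^term>\<open>T\<close>. The last
  conjunct is the standing assumption that some critical point is mapped to 0.\<close>

definition random_critically_finite_map ::
  "'w measure \<Rightarrow> ('w \<Rightarrow> 'w) \<Rightarrow> ('w \<Rightarrow> real \<Rightarrow> real) \<Rightarrow>
   real set set \<Rightarrow> real set set \<Rightarrow> real set \<Rightarrow> real set \<Rightarrow> real \<Rightarrow> real \<Rightarrow> (real set \<Rightarrow> nat) \<Rightarrow>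
   (real set \<Rightarrow> real) \<Rightarrow> (real set \<Rightarrow> real) \<Rightarrow> bool" where
  "random_critically_finite_map M \<theta> T GC GE D0 D1 \<kappa> A \<gamma> c v \<longleftrightarrow>
     prob_space M \<and> complete_measure M \<and> ergodic_automorphism M \<theta> \<and>
     interval_system GC GE D0 D1 \<and> 1 < \<kappa> \<and> 1 < A \<and> (\<forall>D\<in>GC. 1 \<le> \<gamma> D) \<and>
     (\<forall>\<omega>\<in>space M. T \<omega> \<in> crit_finite_class GC GE D0 D1 \<kappa> A \<gamma> c v) \<and>
     (\<forall>x\<in>\<Union>(GC \<union> GE). (\<lambda>\<omega>. T \<omega> x) \<in> borel_measurable M) \<and>
     (\<exists>D\<in>GC. v D = 0)"

text \<open>\<open>T\<^sub>\<omega>\<^sup>n\<close>; meaningful as long as the orbit stays in the union of the intervals.\<close>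

fun cocycle :: "('w \<Rightarrow> 'w) \<Rightarrow> ('w \<Rightarrow> real \<Rightarrow> real) \<Rightarrow> nat \<Rightarrow> 'w \<Rightarrow> real \<Rightarrow> real" where
  "cocycle \<theta> T 0 \<omega> x = x"
| "cocycle \<theta> T (Suc n) \<omega> x = T ((\<theta> ^^ n) \<omega>) (cocycle \<theta> T n \<omega> x)"


section \<open>Truncated systems\<close>

text \<open>\<open>T\<^bsub>\<omega>,0\<^esub>\<^sup>-\<^sup>k\<close>, the composition of the inverse branches onto \<^term>\<open>D0\<close>.\<close>

fun pullback0 ::
  "('w \<Rightarrow> 'w) \<Rightarrow> ('w \<Rightarrow> real \<Rightarrow> real) \<Rightarrow> real set \<Rightarrow> nat \<Rightarrow> 'w \<Rightarrow> real \<Rightarrow> real" where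
  "pullback0 \<theta> T D0 0 \<omega> x = x"
| "pullback0 \<theta> T D0 (Suc k) \<omega> x = inv_into D0 (T \<omega>) (pullback0 \<theta> T D0 k (\<theta> \<omega>) x)"

definition trunc_interval ::
  "('w \<Rightarrow> 'w) \<Rightarrow> ('w \<Rightarrow> real \<Rightarrow> real) \<Rightarrow> real set \<Rightarrow> nat \<Rightarrow> 'w \<Rightarrow> real set" where
  "trunc_interval \<theta> T D0 k \<omega> = {pullback0 \<theta> T D0 k \<omega> 1..1}"

definition trunc_julia ::
  "('w \<Rightarrow> 'w) \<Rightarrow> ('w \<Rightarrow> real \<Rightarrow> real) \<Rightarrow> real set set \<Rightarrow> real set \<Rightarrow> nat \<Rightarrow> 'w \<Rightarrow> real set" where
  "trunc_julia \<theta> T G D0 k \<omega> =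
     {x. \<forall>n. cocycle \<theta> T n \<omega> x \<in> \<Union>G \<inter> trunc_interval \<theta> T D0 k ((\<theta> ^^ n) \<omega>)}"

text \<open>For \<open>k \<ge> 1\<close> the set \<^const>\<open>trunc_julia\<close> contains no endpoint of an interval of the collection: such a
  point is mapped to 0 or 1, hence to 0 after at most two steps, and 0 is not in
  \<^const>\<open>trunc_interval\<close>. So the two-sided derivative below is the derivative within the interval.\<close>

definition transfer_op ::
  "('w \<Rightarrow> 'w) \<Rightarrow> ('w \<Rightarrow> real \<Rightarrow> real) \<Rightarrow> real set set \<Rightarrow> real set \<Rightarrow> real \<Rightarrow> nat \<Rightarrow> 'w \<Rightarrow>
   (real \<Rightarrow> real) \<Rightarrow> real \<Rightarrow> real" where
  "transfer_op \<theta> T G D0 t k \<omega> g x =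
     (\<Sum>y\<in>{y \<in> trunc_julia \<theta> T G D0 k \<omega>. T \<omega> y = x}. g y * \<bar>deriv (T \<omega>) y\<bar> powr (- t))"


section \<open>Random conformal measures and pressure\<close>

abbreviation unit_borel :: "real measure" where
  "unit_borel \<equiv> restrict_space borel {0..1}"

definition random_prob_measure :: "'w measure \<Rightarrow> ('w \<times> real) measure \<Rightarrow> bool" where
  "random_prob_measure M N \<longleftrightarrow>
     prob_space N \<and> sets N = sets (M \<Otimes>\<^sub>M unit_borel) \<and> distr N M fst = M"

definition disintegration ::
  "'w measure \<Rightarrow> ('w \<times> real) measure \<Rightarrow> ('w \<Rightarrow> real measure) \<Rightarrow> bool" where
  "disintegration M N \<nu> \<longleftrightarrow>
     \<nu> \<in> measurable M (prob_algebra unit_borel) \<and>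
     (\<forall>B\<in>sets (M \<Otimes>\<^sub>M unit_borel). emeasure N B = (\<integral>\<^sup>+\<omega>. emeasure (\<nu> \<omega>) (Pair \<omega> -` B) \<partial>M))"

text \<open>\<^term>\<open>N\<close> is a random probability measure with disintegration \<^term>\<open>\<nu>\<close>, supported on the truncated
  system, and the dual transfer operators map \<^term>\<open>\<nu> (\<theta> \<omega>)\<close> to \<^term>\<open>\<Lambda> \<omega>\<close> times \<^term>\<open>\<nu> \<omega>\<close>.\<close>

definition conformal ::
  "'w measure \<Rightarrow> ('w \<Rightarrow> 'w) \<Rightarrow> ('w \<Rightarrow> real \<Rightarrow> real) \<Rightarrow> real set set \<Rightarrow> real set \<Rightarrow> real \<Rightarrow> nat \<Rightarrow>
   ('w \<times> real) measure \<Rightarrow> ('w \<Rightarrow> real measure) \<Rightarrow> ('w \<Rightarrow> real) \<Rightarrow> bool" where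
  "conformal M \<theta> T G D0 t k N \<nu> \<Lambda> \<longleftrightarrow>
     random_prob_measure M N \<and> disintegration M N \<nu> \<and>
     (AE z in N. z \<in> (SIGMA \<omega>:space M. trunc_julia \<theta> T G D0 k \<omega>)) \<and>
     \<Lambda> \<in> borel_measurable M \<and> (\<forall>\<omega>\<in>space M. 0 < \<Lambda> \<omega>) \<and>
     (AE \<omega> in M. \<forall>g. continuous_on (trunc_julia \<theta> T G D0 k \<omega>) g \<longrightarrow>
        (LINT x:trunc_julia \<theta> T G D0 k (\<theta> \<omega>)|\<nu> (\<theta> \<omega>). transfer_op \<theta> T G D0 t k \<omega> g x)
        = \<Lambda> \<omega> * (LINT x:trunc_julia \<theta> T G D0 k \<omega>|\<nu> \<omega>. g x))"

text \<open>In the following \<^term>\<open>\<Lambda> t k\<close> is the eigenvalue function for the parameters \<open>t\<close> and \<open>k\<close>.\<close>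

definition EP :: "'w measure \<Rightarrow> (real \<Rightarrow> nat \<Rightarrow> 'w \<Rightarrow> real) \<Rightarrow> nat \<Rightarrow> real \<Rightarrow> real" where
  "EP M \<Lambda> k t = (\<integral>\<omega>. ln (\<Lambda> t k \<omega>) \<partial>M)"

definition EP_inf :: "'w measure \<Rightarrow> (real \<Rightarrow> nat \<Rightarrow> 'w \<Rightarrow> real) \<Rightarrow> real \<Rightarrow> ereal" where
  "EP_inf M \<Lambda> t = lim (\<lambda>k. ereal (EP M \<Lambda> k t))"

definition D_set :: "'w measure \<Rightarrow> (real \<Rightarrow> nat \<Rightarrow> 'w \<Rightarrow> real) \<Rightarrow> real set" where
  "D_set M \<Lambda> = {t. 0 \<le> t \<and> 0 \<le> EP_inf M \<Lambda> t}"

definition b_sup :: "'w measure \<Rightarrow> (real \<Rightarrow> nat \<Rightarrow> 'w \<Rightarrow> real) \<Rightarrow> ennreal" where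
  "b_sup M \<Lambda> = (SUP t\<in>D_set M \<Lambda>. ennreal t)"

end

theory Submission
  imports Defs
begin

text \<open>An inverse branch \<open>g\<close> of an iterate \<open>T\<^sup>n\<close> has positive Schwarzian derivative, so \<open>\<bar>g'\<bar>\<close> to the power
  \<open>-1/2\<close> is a positive concave function on \<open>(0, 1)\<close>. On the truncated systems, which keep a distance
  depending only on \<open>k\<close> from 0 and 1, this bounds the distortion of \<open>T\<^sup>n\<close> and bounds \<open>\<bar>(T\<^sup>n)'\<bar>\<close> from below,
  uniformly in \<open>n\<close> and \<open>\<omega>\<close>. The product of the eigenvalues along an orbit lies between the minimum and the
  maximum of the iterated transfer operator applied to 1, hence the pressure of the \<open>k\<close>-th system is
  nondecreasing in \<open>k\<close> and nonincreasing in \<open>t\<close>. As \<open>\<bar>T'\<bar> \<le> A\<close>, it decreases with slope at least \<open>- ln A\<close>,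
  whatever \<open>k\<close> is. All this passes to the limit, which at 0 is nonnegative, and a nonincreasing function
  that drops at a bounded rate has the value 0 at the supremum of the set where it is nonnegative.\<close>

text \<open>Critical points allow |T'| < 1, so raising \<open>t\<close> can enlarge single terms of
  a transfer operator, and monotonicity in \<open>t\<close> cannot be read off one step. For
  iterates, the uniform lower bound turns this loss into a factor independent of \<open>n\<close>,
  which is harmless after taking logarithms and dividing by \<open>n\<close>. The exponent -1/2 is
  chosen because mixed first-derivative terms then cancel under composition, so concavity passes to
  iterates of any length without loss. The second obstacle is the truncation: whether an inverse
  word stays in the truncated system depends on its starting point, so the sums at two points run
  over different words. One extra step through \<open>D1\<close>, whose branch is never truncated,
  moves one of the two points to the right of every cut \<open>p m\<close> with m >= 1; each word
  admissible for the other point is then admissible for it. The price is one iterate and a factor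
  \<open>A powr t'\<close>. The distortion constant involves only the smaller level
  \<open>k\<close>, and \<open>n\<close> tends to infinity before \<open>k\<close> does.\<close>

section \<open>Distortion of inverse branches\<close>

text \<open>Here \<^term>\<open>\<phi>\<close> is \<open>\<bar>g'\<bar>\<close> to the power \<open>-1/2\<close>; it is concave iff the Schwarzian derivative
  of \<^term>\<open>g\<close> is nonnegative.\<close>

definition concave_branch :: "(real \<Rightarrow> real) \<Rightarrow> (real \<Rightarrow> real) \<Rightarrow> bool" where
  "concave_branch g \<phi> \<longleftrightarrow>
     (\<exists>s \<phi>' \<phi>''. \<bar>s\<bar> = 1 \<and> (\<forall>x\<in>{0<..<1}. g x \<in> {0<..<1} \<and> 0 < \<phi> x \<and>
        (g has_real_derivative s / (\<phi> x)\<^sup>2) (at x) \<and>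
        (\<phi> has_real_derivative \<phi>' x) (at x) \<and>
        (\<phi>' has_real_derivative \<phi>'' x) (at x) \<and> \<phi>'' x \<le> 0))"

lemma concave_branchD:
  assumes "concave_branch g \<phi>" "0 < x" "x < 1"
  shows "0 < g x" "g x < 1" "0 < \<phi> x" "isCont g x" "isCont \<phi> x"
  using assms unfolding concave_branch_def by (auto dest!: bspec[where x = x] intro: DERIV_isCont)

lemma concave_branch_id: "concave_branch (\<lambda>x. x) (\<lambda>x. 1)"
  unfolding concave_branch_def
  by (rule exI[of _ 1], rule exI[of _ "\<lambda>_. 0"], rule exI[of _ "\<lambda>_. 0"]) auto

text \<open>In the second derivative of the product the two terms with
  \<open>\<phi>1 (h x) * \<psi>1 x\<close> cancel, which leaves the two nonpositive terms of
  \<open>\<xi>2\<close>. This is the rule S(g o h) = (Sg o h) h'^2 + Sh, rewritten for the power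
  -1/2 of the derivative.\<close>

lemma concave_branch_compose:
  assumes "concave_branch g \<phi>" "concave_branch h \<psi>"
  shows "concave_branch (\<lambda>x. g (h x)) (\<lambda>x. \<phi> (h x) * \<psi> x)"
proof -
  obtain s \<phi>1 \<phi>2 where s: "\<bar>s\<bar> = 1" and g: "\<And>x. x \<in> {0<..<1} \<Longrightarrow> g x \<in> {0<..<1} \<and> 0 < \<phi> x \<and>
        (g has_real_derivative s / (\<phi> x)\<^sup>2) (at x) \<and>
        (\<phi> has_real_derivative \<phi>1 x) (at x) \<and>
        (\<phi>1 has_real_derivative \<phi>2 x) (at x) \<and> \<phi>2 x \<le> 0"
    using assms(1) unfolding concave_branch_def by blast
  obtain r \<psi>1 \<psi>2 where r: "\<bar>r\<bar> = 1" and h: "\<And>x. x \<in> {0<..<1} \<Longrightarrow> h x \<in> {0<..<1} \<and> 0 < \<psi> x \<and>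
        (h has_real_derivative r / (\<psi> x)\<^sup>2) (at x) \<and>
        (\<psi> has_real_derivative \<psi>1 x) (at x) \<and>
        (\<psi>1 has_real_derivative \<psi>2 x) (at x) \<and> \<psi>2 x \<le> 0"
    using assms(2) unfolding concave_branch_def by blast
  define \<xi>1 where "\<xi>1 = (\<lambda>x. r * \<phi>1 (h x) / \<psi> x + \<phi> (h x) * \<psi>1 x)"
  define \<xi>2 where "\<xi>2 = (\<lambda>x. \<phi>2 (h x) / (\<psi> x)^3 + \<phi> (h x) * \<psi>2 x)"
  have rr: "r * r = 1" using r by (metis abs_mult_self_eq mult_1_right)
  have "g (h x) \<in> {0<..<1} \<and> 0 < \<phi> (h x) * \<psi> x \<and>
        ((\<lambda>x. g (h x)) has_real_derivative (s * r) / (\<phi> (h x) * \<psi> x)\<^sup>2) (at x) \<and>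
        ((\<lambda>x. \<phi> (h x) * \<psi> x) has_real_derivative \<xi>1 x) (at x) \<and>
        (\<xi>1 has_real_derivative \<xi>2 x) (at x) \<and> \<xi>2 x \<le> 0" if x: "x \<in> {0<..<1}" for x
  proof -
    have hx: "h x \<in> {0<..<1}" and p: "0 < \<psi> x" using h[OF x] by auto
    have q: "0 < \<phi> (h x)" using g[OF hx] by auto
    have dh: "(h has_real_derivative r / (\<psi> x)\<^sup>2) (at x)" using h[OF x] by auto
    have d1: "((\<lambda>x. g (h x)) has_real_derivative s / (\<phi> (h x))\<^sup>2 * (r / (\<psi> x)\<^sup>2)) (at x)"
      using DERIV_chain2[OF _ dh] g[OF hx] by blast
    have d2: "((\<lambda>x. \<phi> (h x)) has_real_derivative \<phi>1 (h x) * (r / (\<psi> x)\<^sup>2)) (at x)"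
      using DERIV_chain2[OF _ dh] g[OF hx] by blast
    have d3: "((\<lambda>x. \<phi>1 (h x)) has_real_derivative \<phi>2 (h x) * (r / (\<psi> x)\<^sup>2)) (at x)"
      using DERIV_chain2[OF _ dh] g[OF hx] by blast
    have e2: "(\<psi> has_real_derivative \<psi>1 x) (at x)" and e3: "(\<psi>1 has_real_derivative \<psi>2 x) (at x)"
      using h[OF x] by auto
    have A: "((\<lambda>x. \<phi> (h x) * \<psi> x) has_real_derivative \<xi>1 x) (at x)"
      by (rule derivative_eq_intros d2 e2 refl)+
         (use p in \<open>simp add: \<xi>1_def field_simps power2_eq_square\<close>)
    have "(\<xi>1 has_real_derivative
       (r * (\<phi>2 (h x) * (r / (\<psi> x)\<^sup>2)) * \<psi> x - r * \<phi>1 (h x) * \<psi>1 x) / (\<psi> x * \<psi> x)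
       + (\<phi>1 (h x) * (r / (\<psi> x)\<^sup>2) * \<psi>1 x + \<psi>2 x * \<phi> (h x))) (at x)"
      unfolding \<xi>1_def
      by (rule derivative_eq_intros d2 d3 e2 e3 refl | use p in simp)+
    moreover have "(r * (\<phi>2 (h x) * (r / (\<psi> x)\<^sup>2)) * \<psi> x - r * \<phi>1 (h x) * \<psi>1 x) / (\<psi> x * \<psi> x)
       + (\<phi>1 (h x) * (r / (\<psi> x)\<^sup>2) * \<psi>1 x + \<psi>2 x * \<phi> (h x)) =
       (r * r) * \<phi>2 (h x) / (\<psi> x)^3 + \<phi> (h x) * \<psi>2 x"
      using p by (simp add: field_simps power2_eq_square power3_eq_cube)
    moreover have "\<dots> = \<xi>2 x" by (simp add: rr \<xi>2_def)
    ultimately have B: "(\<xi>1 has_real_derivative \<xi>2 x) (at x)" by (simp only:)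
    have "\<xi>2 x \<le> 0" using p q g[OF hx] h[OF x] unfolding \<xi>2_def
      by (intro add_nonpos_nonpos) (auto simp: divide_le_0_iff mult_le_0_iff)
    with A B d1 g[OF hx] p q show ?thesis by (simp add: power_mult_distrib)
  qed
  moreover have "\<bar>s * r\<bar> = 1" using s r by (simp add: abs_mult)
  ultimately show ?thesis unfolding concave_branch_def by blast
qed

lemma concave_branch_cong:
  assumes "concave_branch g \<phi>" "\<And>x. x \<in> {0<..<1} \<Longrightarrow> \<phi> x = \<psi> x"
  shows "concave_branch g \<psi>"
proof -
  obtain s \<phi>1 \<phi>2 where s: "\<bar>s\<bar> = 1" and g: "\<And>x. x \<in> {0<..<1} \<Longrightarrow> g x \<in> {0<..<1} \<and> 0 < \<phi> x \<and>
        (g has_real_derivative s / (\<phi> x)\<^sup>2) (at x) \<and>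
        (\<phi> has_real_derivative \<phi>1 x) (at x) \<and>
        (\<phi>1 has_real_derivative \<phi>2 x) (at x) \<and> \<phi>2 x \<le> 0"
    using assms(1) unfolding concave_branch_def by blast
  have "(\<psi> has_real_derivative \<phi>1 x) (at x)" if "x \<in> {0<..<1}" for x
    by (rule has_field_derivative_transform_within_open[where f = \<phi> and S = "{0<..<1}"])
       (use that g assms(2) in auto)
  with s g assms(2) show ?thesis unfolding concave_branch_def by metis
qed

lemma concave_branch_concave_on:
  assumes "concave_branch g \<phi>"
  shows "concave_on {0<..<1} \<phi>"
proof -
  obtain s \<phi>1 \<phi>2 where g: "\<And>x. x \<in> {0<..<1} \<Longrightarrow> 
        (\<phi> has_real_derivative \<phi>1 x) (at x) \<and>
        (\<phi>1 has_real_derivative \<phi>2 x) (at x) \<and> \<phi>2 x \<le> 0"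
    using assms(1) unfolding concave_branch_def by blast
  show ?thesis
    by (rule f''_le0_imp_concave[where f' = \<phi>1 and f'' = \<phi>2]) (use g in auto)
qed

text \<open>A Koebe distortion estimate, which holds because a positive concave function lies above its chords
  to the endpoints.\<close>

lemma concave_branch_distortion:
  assumes "concave_branch g \<phi>" "0 < x" "x < 1" "0 < y" "y < 1"
  shows "min y (1 - y) / 2 * \<phi> x \<le> \<phi> y"
proof -
  note conc = concave_onD[OF concave_branch_concave_on[OF assms(1)]]
  note pos = concave_branchD(3)[OF assms(1)]
  have px: "0 < \<phi> x" using pos assms by simp
  consider "x = y" | "y < x" | "x < y" by linarith
  then show ?thesis
  proof cases
    case 1
    have "min y (1 - y) / 2 \<le> 1" using assms by auto
    then have "min y (1 - y) / 2 * \<phi> x \<le> 1 * \<phi> x" using px by (intro mult_right_mono) auto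
    with 1 show ?thesis by simp
  next
    case 2
    \<comment> \<open>\<open>y\<close> is the convex combination of y/2 and \<open>x\<close> with
      weight \<open>t\<close> at \<open>x\<close>. The point y/2 stands in for the endpoint 0, which
      lies outside the domain of concavity; this is the origin of the factor 1/2.\<close>
    define t where "t = (y / 2) / (x - y / 2)"
    have t: "0 \<le> t" "t \<le> 1" unfolding t_def using 2 assms by (auto simp: field_simps)
    have "y / 2 * (x - y / 2) \<le> y / 2" using 2 assms by (intro mult_left_le) auto
    then have t': "y / 2 \<le> t" unfolding t_def using 2 assms by (simp add: le_divide_eq)
    have "(1 - t) * \<phi> (y/2) + t * \<phi> x \<le> \<phi> ((1 - t) *\<^sub>R (y/2) + t *\<^sub>R x)"
      using t assms by (intro conc) auto
    also have "(1 - t) *\<^sub>R (y/2) + t *\<^sub>R x = y / 2 + t * (x - y / 2)" by (simp add: field_simps)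
    also have "t * (x - y / 2) = y / 2"
      using nonzero_eq_divide_eq[of "x - y / 2" t "y / 2"] 2 assms by (simp add: t_def)
    finally have "(1 - t) * \<phi> (y/2) + t * \<phi> x \<le> \<phi> y" by simp
    then have "t * \<phi> x \<le> \<phi> y" using t pos[of "y/2"] assms
      by (smt (verit) mult_nonneg_nonneg field_sum_of_halves)
    moreover have "min y (1 - y) / 2 * \<phi> x \<le> t * \<phi> x"
      using t' px by (intro mult_right_mono) auto
    ultimately show ?thesis by linarith
  next
    case 3
    \<comment> \<open>Mirror image: the midpoint of \<open>y\<close> and 1 stands in for the
      endpoint 1.\<close>
    define u where "u = (1 + y) / 2"
    define t where "t = ((1 - y) / 2) / (u - x)"
    have u: "y < u" "u < 1" "u - y = (1 - y) / 2" using assms by (auto simp: u_def field_simps)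
    have t: "0 \<le> t" "t \<le> 1" unfolding t_def using 3 assms u
      by (auto simp: field_simps)
    have "(1 - y) / 2 * (u - x) \<le> (1 - y) / 2" using 3 assms u by (intro mult_left_le) auto
    then have t': "(1 - y) / 2 \<le> t" unfolding t_def using 3 u by (subst pos_le_divide_eq) linarith+
    have "(1 - t) * \<phi> u + t * \<phi> x \<le> \<phi> ((1 - t) *\<^sub>R u + t *\<^sub>R x)"
      using t assms u by (intro conc) auto
    also have "(1 - t) *\<^sub>R u + t *\<^sub>R x = u - t * (u - x)" by (simp add: algebra_simps)
    also have "t * (u - x) = (1 - y) / 2"
      using nonzero_eq_divide_eq[of "u - x" t "(1 - y) / 2"] 3 u by (simp add: t_def)
    also have "u - (1 - y) / 2 = y" using u(3) by linarith
    finally have "t * \<phi> x \<le> \<phi> y" using t pos[of u] assms u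
      by (smt (verit) mult_nonneg_nonneg)
    moreover have "min y (1 - y) / 2 * \<phi> x \<le> t * \<phi> x"
      using t' px by (intro mult_right_mono) auto
    ultimately show ?thesis by linarith
  qed
qed

text \<open>As \<open>g\<close> takes values in (0,1), the mean value theorem on [1/4, 3/4] yields a
  point with |g'| <= 2, where \<open>\<phi>\<close> is at least 1/2. The distortion estimate carries
  this to \<open>y\<close>, so no constant depends on \<open>g\<close>.\<close>

lemma concave_branch_lower_bound:
  assumes "concave_branch g \<phi>" "0 < y" "y < 1"
  shows "min y (1 - y) / 4 \<le> \<phi> y"
proof -
  obtain s where s: "\<bar>s\<bar> = 1" and g: "\<And>x. x \<in> {0<..<1} \<Longrightarrow> g x \<in> {0<..<1} \<and> 0 < \<phi> x \<and>
        (g has_real_derivative s / (\<phi> x)\<^sup>2) (at x)"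
    using assms(1) unfolding concave_branch_def by blast
  have "\<exists>z::real. 1/4 < z \<and> z < 3/4 \<and> g (3/4) - g (1/4) = (3/4 - 1/4) * (s / (\<phi> z)\<^sup>2)"
    by (rule MVT2) (use g in auto)
  then obtain z :: real where z: "1/4 < z" "z < 3/4" "g (3/4) - g (1/4) = (3/4 - 1/4) * (s / (\<phi> z)\<^sup>2)" by blast
  have pz: "0 < \<phi> z" using g[of z] z by auto
  have "\<bar>(3/4 - 1/4) * (s / (\<phi> z)\<^sup>2)\<bar> \<le> 1"
    using z(3) g[of "3/4"] g[of "1/4"] by auto
  then have "1 / 2 \<le> (\<phi> z)\<^sup>2" using s pz by (simp add: abs_mult field_simps)
  then have "1 / 2 \<le> \<phi> z" using pz
    by (smt (verit, best) field_sum_of_halves mult_left_le_one_le power2_eq_square real_sqrt_pow2 power_mono power_one_over)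
  then have "min y (1 - y) / 2 * (1 / 2) \<le> min y (1 - y) / 2 * \<phi> z"
    using assms by (intro mult_left_mono) auto
  also have "\<dots> \<le> \<phi> y" using concave_branch_distortion[OF assms(1)] z assms by simp
  finally show ?thesis by simp
qed

section \<open>A single critically finite map\<close>

definition inverse_branch :: "(real \<Rightarrow> real) \<Rightarrow> real set \<Rightarrow> real \<Rightarrow> real" where
  "inverse_branch f D = inv_into D f"

text \<open>For g the inverse branch, g' = 1 / f'(g), so this is |g'| to the power -1/2. Its square
  is the derivative that enters the transfer operator. Being built on the two-sided derivative, it
  is used for \<open>x\<close> in (0,1) only.\<close>

definition branch_weight :: "(real \<Rightarrow> real) \<Rightarrow> real set \<Rightarrow> real \<Rightarrow> real" where
  "branch_weight f D x = sqrt \<bar>deriv f (inverse_branch f D x)\<bar>"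

locale critically_finite_map =
  fixes f :: "real \<Rightarrow> real" and GC GE :: "real set set" and D0 D1 :: "real set"
    and \<kappa> A :: real and \<gamma> :: "real set \<Rightarrow> nat" and c v :: "real set \<Rightarrow> real"
  assumes system: "interval_system GC GE D0 D1"
    and \<kappa>: "1 < \<kappa>" and A: "1 < A"
    and f_class: "f \<in> crit_finite_class GC GE D0 D1 \<kappa> A \<gamma> c v"
begin

abbreviation "G \<equiv> GC \<union> GE"

abbreviation "branch \<equiv> inverse_branch f"

lemma finite_G: "finite G"
  using system by (simp add: interval_system_def)

lemma interval: "D \<in> G \<Longrightarrow> \<exists>a b. 0 \<le> a \<and> a < b \<and> b \<le> 1 \<and> D = {a..b}"
  using system by (simp add: interval_system_def)

lemma D0_G: "D0 \<in> G" and D1_G: "D1 \<in> G" and D0_neq_D1: "D0 \<noteq> D1" and zero_D0: "0 \<in> D0" and one_D1: "1 \<in> D1"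
  using system by (simp_all add: interval_system_def)

lemma interior_disjoint: "D \<in> G \<Longrightarrow> E \<in> G \<Longrightarrow> D \<noteq> E \<Longrightarrow> interior D \<inter> interior E = {}"
  using system by (simp add: interval_system_def)

lemma cont: "continuous_on (\<Union>G) f"
  and f_0: "f 0 = 0" and f_1: "f 1 = 0"
  and deriv_on_le: "D \<in> G \<Longrightarrow> x \<in> D \<Longrightarrow> \<bar>deriv_on D f x\<bar> \<le> A"
  and C3: "D \<in> G \<Longrightarrow> Cn_on 3 D f"
  and inj: "D \<in> G \<Longrightarrow> inj_on f D"
  and onto: "D \<in> G \<Longrightarrow> f ` D = {0..1}"
  and schwarzian: "D \<in> G \<Longrightarrow> x \<in> D \<Longrightarrow> deriv_on D f x \<noteq> 0 \<Longrightarrow> schwarzian_on D f x < 0"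
  using f_class by (simp_all add: crit_finite_class_def)

text \<open>Expansion excludes zeros on \<open>GE\<close>; on \<open>GC\<close> the only zero is
  \<open>c D\<close>, a frontier point.\<close>

lemma deriv_on_nonzero:
  assumes "D \<in> G" "x \<in> interior D"
  shows "deriv_on D f x \<noteq> 0"
proof -
  have x: "x \<in> D" using assms(2) interior_subset by blast
  show ?thesis
  proof (cases "D \<in> GE")
    case True
    then have "\<kappa> \<le> \<bar>deriv_on D f x\<bar>"
      using f_class x by (simp add: crit_finite_class_def)
    with \<kappa> show ?thesis by auto
  next
    case False
    then have "c D \<in> frontier D" "deriv_on D f x = 0 \<longleftrightarrow> x = c D"
      using f_class assms(1) x by (auto simp: crit_finite_class_def)
    then show ?thesis using assms(2) by (auto simp: frontier_def)
  qed
qed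

lemma cont_D: "D \<in> G \<Longrightarrow> continuous_on D f"
  using cont by (rule continuous_on_subset) blast

text \<open>At an interior point a continuous injective function lies strictly between its values at
  the two ends, so the extreme values 0 and 1 can only be taken at the ends.\<close>

lemma endpoint_values:
  assumes "{a..b} \<in> G" "a < b"
  shows "f a = 0 \<and> f b = 1 \<or> f a = 1 \<and> f b = 0"
proof -
  have R: "\<And>x. x \<in> {a..b} \<Longrightarrow> 0 \<le> f x \<and> f x \<le> 1" using onto[OF assms(1)] by auto
  have *: "u = a \<or> u = b" if u: "u \<in> {a..b}" "f u = 0 \<or> f u = 1" for u
  proof (rule ccontr)
    assume "\<not> (u = a \<or> u = b)"
    then have "a < u" "u < b" using u by auto
    from continuous_inj_imp_mono[OF this cont_D[OF assms(1)] inj[OF assms(1)]]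
    show False using u R[of a] R[of b] assms(2) by auto
  qed
  obtain u where u: "u \<in> {a..b}" "f u = 0" using onto[OF assms(1)] by (metis atLeastAtMost_iff imageE order_refl zero_le_one)
  obtain w where w: "w \<in> {a..b}" "f w = 1" using onto[OF assms(1)] by (metis atLeastAtMost_iff imageE order_refl zero_le_one)
  show ?thesis using *[of u] *[of w] u w by auto
qed

text \<open>The sign \<open>s\<close> covers increasing and decreasing branches at once; later it is
  the sign of the derivative.\<close>

lemma mono_D:
  assumes "D \<in> G"
  obtains s where "\<bar>s\<bar> = 1" "mono_on D (\<lambda>x. s * f x)"
proof -
  obtain a b where ab: "a < b" "D = {a..b}" using interval[OF assms] by blast
  have G: "{a..b} \<in> G" using ab assms by simp
  have R: "\<And>x. x \<in> {a..b} \<Longrightarrow> 0 \<le> f x \<and> f x \<le> 1" using onto[OF G] by auto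
  have *: "f a = 0 \<and> f x \<le> f y \<or> f a = 1 \<and> f y \<le> f x" if "a \<le> x" "x < y" "y \<le> b" for x y
  proof (cases "x = a")
    case True
    then show ?thesis using endpoint_values[OF G ab(1)] R[of y] that by auto
  next
    case False
    have sub: "{a..y} \<subseteq> {a..b}" and ax: "a < x" using False that by auto
    have "f a < f x \<and> f x < f y \<or> f y < f x \<and> f x < f a"
      by (rule continuous_inj_imp_mono[OF ax that(2) continuous_on_subset[OF cont_D[OF G] sub]
            inj_on_subset[OF inj[OF G] sub]])
    then show ?thesis using endpoint_values[OF G ab(1)] R[of y] R[of x] that by auto
  qed
  show thesis
  proof (cases "f a = 0")
    case True
    have "mono_on D (\<lambda>x. 1 * f x)"
    proof (rule monotone_onI)
      fix x y assume "x \<in> D" "y \<in> D" "x \<le> y"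
      then show "1 * f x \<le> 1 * f y" using *[of x y] True ab by (cases "x = y") auto
    qed
    then show thesis using that[of 1] by simp
  next
    case False
    have "mono_on D (\<lambda>x. - 1 * f x)"
    proof (rule monotone_onI)
      fix x y assume "x \<in> D" "y \<in> D" "x \<le> y"
      then show "- 1 * f x \<le> - 1 * f y" using *[of x y] False ab by (cases "x = y") auto
    qed
    then show thesis using that[of "- 1"] by simp
  qed
qed

section \<open>Inverse branches as maps of [0,1] onto the intervals\<close>

lemma branch_in: "D \<in> G \<Longrightarrow> x \<in> {0..1} \<Longrightarrow> branch D x \<in> D"
  and f_branch: "D \<in> G \<Longrightarrow> x \<in> {0..1} \<Longrightarrow> f (branch D x) = x"
  and branch_f: "D \<in> G \<Longrightarrow> y \<in> D \<Longrightarrow> branch D (f y) = y"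
  unfolding inverse_branch_def using onto[of D] inj[of D]
  by (auto simp: inv_into_into f_inv_into_f inv_into_f_f)

lemma branch_interior:
  assumes "D \<in> G" "0 < x" "x < 1"
  shows "branch D x \<in> interior D"
proof -
  obtain a b where ab: "a < b" "D = {a..b}" using interval[OF assms(1)] by blast
  have "branch D x \<in> {a..b}" "f (branch D x) = x" using branch_in[of D x] f_branch[of D x] assms ab by auto
  moreover have "branch D x \<noteq> a" "branch D x \<noteq> b"
    using endpoint_values[of a b] assms ab \<open>f (branch D x) = x\<close> by auto
  ultimately show ?thesis using ab by auto
qed

lemma branch_unit_interval:
  assumes "D \<in> G" "0 < x" "x < 1"
  shows "0 < branch D x" "branch D x < 1"
proof -
  obtain a b where ab: "0 \<le> a" "a < b" "b \<le> 1" "D = {a..b}" using interval[OF assms(1)] by blast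
  then show "0 < branch D x" "branch D x < 1" using branch_interior[OF assms] by auto
qed

text \<open>Neighbouring intervals may share an endpoint, but endpoints are mapped to 0 or 1. This
  is what lets a sum over preimages become a sum over intervals without double counting.\<close>

lemma branch_inject:
  assumes "D \<in> G" "E \<in> G" "0 < x" "x < 1" "branch D x = branch E x"
  shows "D = E"
  using interior_disjoint[OF assms(1,2)] branch_interior[OF assms(1,3,4)]
    branch_interior[OF assms(2,3,4)] assms(5) by auto

lemma continuous_branch:
  assumes "D \<in> G"
  shows "continuous_on {0..1} (branch D)"
proof -
  have "compact D" using interval[OF assms] by auto
  from continuous_on_inv[OF cont_D[OF assms] this, of "branch D"] show ?thesis
    using branch_f[OF assms] onto[OF assms] by simp
qed

section \<open>Derivatives of the inverse branches and the sign of the Schwarzian\<close>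

lemma DERIV_deriv_on:
  assumes "g differentiable_on D" "y \<in> interior D"
  shows "(g has_real_derivative deriv_on D g y) (at y)"
proof -
  have "g differentiable (at y within D)" using assms interior_subset unfolding differentiable_on_def by blast
  then have "(g has_vector_derivative deriv_on D g y) (at y within D)"
    unfolding deriv_on_def by (simp add: vector_derivative_works)
  then show ?thesis
    unfolding at_within_interior[OF assms(2)] has_real_derivative_iff_has_vector_derivative .
qed

lemma DERIV_interior:
  assumes "D \<in> G" "y \<in> interior D"
  shows "(f has_real_derivative deriv_on D f y) (at y)"
    "((deriv_on D f) has_real_derivative deriv_on D (deriv_on D f) y) (at y)"
    "((deriv_on D (deriv_on D f)) has_real_derivative deriv_on D (deriv_on D (deriv_on D f)) y) (at y)"
    "deriv f y = deriv_on D f y"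
proof -
  have C: "(deriv_on D ^^ j) f differentiable_on D" if "j < 3" for j
    using C3[OF assms(1)] that unfolding Cn_on_def by blast
  show 1: "(f has_real_derivative deriv_on D f y) (at y)"
    using DERIV_deriv_on[OF C[of 0] assms(2)] by simp
  show "((deriv_on D f) has_real_derivative deriv_on D (deriv_on D f) y) (at y)"
    using DERIV_deriv_on[OF C[of 1] assms(2)] by simp
  show "((deriv_on D (deriv_on D f)) has_real_derivative deriv_on D (deriv_on D (deriv_on D f)) y) (at y)"
    using DERIV_deriv_on[OF C[of 2] assms(2)] by (simp add: numeral_2_eq_2)
  show "deriv f y = deriv_on D f y" using 1 by (rule DERIV_imp_deriv)
qed

lemma DERIV_branch:
  assumes "D \<in> G" "0 < x" "x < 1"
  shows "(branch D has_real_derivative 1 / deriv_on D f (branch D x)) (at x)"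
proof -
  have "(branch D has_real_derivative inverse (deriv_on D f (branch D x))) (at x)"
  proof (rule DERIV_inverse_function[where a = 0 and b = 1 and f = f])
    show "(f has_real_derivative deriv_on D f (branch D x)) (at (branch D x))"
      by (intro DERIV_interior branch_interior assms)
    show "deriv_on D f (branch D x) \<noteq> 0" by (intro deriv_on_nonzero branch_interior assms)
    show "isCont (branch D) x"
      using continuous_on_interior[OF continuous_branch[OF assms(1)]] assms by auto
  qed (use assms f_branch in auto)
  then show ?thesis by (simp add: inverse_eq_divide)
qed

abbreviation "weight \<equiv> branch_weight f"

text \<open>The second derivative of the weight is \<open>Sf / (2 weight^3)\<close>, evaluated at the branch.\<close>

lemma concave_branch_branch:
  assumes D: "D \<in> G"
  shows "concave_branch (branch D) (weight D)"
proof -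
  obtain s where s: "\<bar>s\<bar> = 1" and mono: "mono_on D (\<lambda>x. s * f x)" using mono_D[OF D] .
  have ss: "s * s = 1" using s by (metis abs_mult_self_eq mult_1_right)
  define f1 f2 f3 where "f1 = deriv_on D f" and "f2 = deriv_on D f1" and "f3 = deriv_on D f2"
  define g where "g = branch D"
  \<comment> \<open>Using \<open>s\<close> in place of an absolute value gives a formula that can be
    differentiated directly; \<open>concave_branch_cong\<close> exchanges it for
    \<open>weight D\<close> at the end.\<close>
  define \<phi> where "\<phi> = (\<lambda>x. sqrt (s * f1 (g x)))"
  define \<phi>1 where "\<phi>1 = (\<lambda>x. s * f2 (g x) / (2 * f1 (g x) * \<phi> x))"
  define \<phi>2 where "\<phi>2 = (\<lambda>x. schwarzian_on D f (g x) / (2 * \<phi> x ^ 3))"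
  have pos: "0 < s * f1 y" if "y \<in> interior D" for y
  proof -
    have "((\<lambda>x. s * f x) has_real_derivative s * f1 y) (at y)"
      using DERIV_interior(1)[OF D that] unfolding f1_def by (rule DERIV_cmult)
    then have "0 \<le> s * f1 y" using mono_on_imp_deriv_nonneg[OF mono] that by blast
    moreover have "s * f1 y \<noteq> 0" using deriv_on_nonzero[OF D that] s by (auto simp: f1_def)
    ultimately show ?thesis by linarith
  qed
  have "g x \<in> {0<..<1} \<and> 0 < \<phi> x \<and>
        (g has_real_derivative s / (\<phi> x)\<^sup>2) (at x) \<and>
        (\<phi> has_real_derivative \<phi>1 x) (at x) \<and>
        (\<phi>1 has_real_derivative \<phi>2 x) (at x) \<and> \<phi>2 x \<le> 0" if x: "x \<in> {0<..<1}" for x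
  proof -
    have i: "g x \<in> interior D" using branch_interior[OF D] x by (simp add: g_def)
    define F where "F = f1 (g x)"
    have F: "0 < s * F" "F \<noteq> 0" using pos[OF i] by (auto simp: F_def)
    have p: "0 < \<phi> x" using F by (simp add: \<phi>_def F_def)
    have p2: "(\<phi> x)\<^sup>2 = s * F" using F by (simp add: \<phi>_def F_def)
    have dg: "(g has_real_derivative 1 / F) (at x)"
      using DERIV_branch[OF D] x by (simp add: g_def f1_def F_def)
    have d1: "((\<lambda>x. f1 (g x)) has_real_derivative f2 (g x) * (1 / F)) (at x)"
      unfolding f1_def f2_def by (rule DERIV_chain2[OF DERIV_interior(2)[OF D i] dg])
    have d2: "((\<lambda>x. f2 (g x)) has_real_derivative f3 (g x) * (1 / F)) (at x)"
      unfolding f1_def f2_def f3_def by (rule DERIV_chain2[OF DERIV_interior(3)[OF D i] dg])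
    have "(\<phi> has_real_derivative (s * (f2 (g x) * (1 / F))) * (inverse (sqrt (s * f1 (g x))) / 2)) (at x)"
      unfolding \<phi>_def
      by (rule DERIV_cong[OF DERIV_chain2[OF DERIV_real_sqrt[OF F(1)[unfolded F_def]]
            DERIV_cmult[OF d1, of s]] mult.commute])
    then have d\<phi>: "(\<phi> has_real_derivative \<phi>1 x) (at x)"
      by (rule DERIV_cong) (simp only: \<phi>1_def \<phi>_def F_def divide_inverse inverse_mult_distrib mult_1_left mult_ac)
    have "(\<phi>1 has_real_derivative
       (s * (f3 (g x) * (1 / F)) * (2 * f1 (g x) * \<phi> x)
         - s * f2 (g x) * (2 * (f2 (g x) * (1 / F)) * \<phi> x + \<phi>1 x * (2 * f1 (g x))))
       / ((2 * f1 (g x) * \<phi> x) * (2 * f1 (g x) * \<phi> x))) (at x)"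
      unfolding \<phi>1_def
      by (rule DERIV_divide DERIV_mult DERIV_cmult d1 d2 d\<phi>[unfolded \<phi>1_def] | use F p in \<open>simp add: F_def\<close>)+
    moreover have "(s * (f3 (g x) * (1 / F)) * (2 * f1 (g x) * \<phi> x)
         - s * f2 (g x) * (2 * (f2 (g x) * (1 / F)) * \<phi> x + \<phi>1 x * (2 * f1 (g x))))
       / ((2 * f1 (g x) * \<phi> x) * (2 * f1 (g x) * \<phi> x)) = \<phi>2 x"
    proof -
      have Fs: "f1 (g x) = s * (\<phi> x)\<^sup>2" "F = s * (\<phi> x)\<^sup>2"
        using p2 ss by (simp_all add: F_def flip: mult.assoc)
      have S: "schwarzian_on D f (g x) = f3 (g x) / F - 3 / 2 * (f2 (g x) / F)\<^sup>2"
        by (simp add: schwarzian_on_def f3_def f2_def f1_def F_def numeral_2_eq_2 numeral_3_eq_3)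
      have "s = 1 \<or> s = - 1" using s by auto
      then show ?thesis
      proof
        assume "s = 1"
        then show ?thesis unfolding \<phi>2_def \<phi>1_def S Fs using p
          by (simp add: field_simps) (simp add: eval_nat_numeral algebra_simps)
      next
        assume "s = - 1"
        then show ?thesis unfolding \<phi>2_def \<phi>1_def S Fs using p
          by (simp add: field_simps) (simp add: eval_nat_numeral algebra_simps)
      qed
    qed
    ultimately have d\<phi>1: "(\<phi>1 has_real_derivative \<phi>2 x) (at x)" by (simp only:)
    have "schwarzian_on D f (g x) < 0"
      using i interior_subset F by (intro schwarzian[OF D]) (auto simp: F_def f1_def)
    then have "\<phi>2 x \<le> 0" using p by (simp add: \<phi>2_def divide_le_0_iff)
    moreover have "s / (s * F) = 1 / F" using s by auto
    then have "(g has_real_derivative s / (\<phi> x)\<^sup>2) (at x)" using dg p2 by simp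
    moreover have "g x \<in> {0<..<1}" using branch_unit_interval[OF D] x by (simp add: g_def)
    ultimately show ?thesis using p d\<phi> d\<phi>1 by blast
  qed
  then have "concave_branch g \<phi>" using s unfolding concave_branch_def by blast
  then show ?thesis unfolding g_def
  proof (rule concave_branch_cong)
    fix x :: real assume "x \<in> {0<..<1}"
    then have i: "branch D x \<in> interior D" using branch_interior[OF D] by simp
    have "\<bar>f1 (branch D x)\<bar> = \<bar>s * f1 (branch D x)\<bar>" using s by (simp add: abs_mult)
    then show "\<phi> x = weight D x"
      using pos[OF i] DERIV_interior(4)[OF D i] by (simp add: \<phi>_def branch_weight_def f1_def g_def)
  qed
qed

lemma weight_le:
  assumes "D \<in> G" "0 < x" "x < 1"
  shows "(weight D x)\<^sup>2 \<le> A"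
proof -
  have i: "branch D x \<in> interior D" using branch_interior assms by simp
  have "\<bar>deriv f (branch D x)\<bar> \<le> A"
    using deriv_on_le[OF assms(1)] DERIV_interior(4)[OF assms(1) i] i interior_subset by fastforce
  then show ?thesis by (simp add: branch_weight_def)
qed

section \<open>Estimates near the two ends of [0,1]\<close>

lemma lipschitz:
  assumes D: "D \<in> G" "x \<in> D" "y \<in> D"
  shows "\<bar>f y - f x\<bar> \<le> A * \<bar>y - x\<bar>"
proof -
  have *: "\<bar>f y - f x\<bar> \<le> A * (y - x)" if xy: "x < y" "x \<in> D" "y \<in> D" for x y
  proof -
    obtain a b where ab: "D = {a..b}" using interval[OF D(1)] by blast
    have i: "z \<in> interior D" if "x < z" "z < y" for z using that xy ab by auto
    have "continuous_on {x..y} f" using xy ab by (intro continuous_on_subset[OF cont_D[OF D(1)]]) auto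
    moreover have "\<And>z. x < z \<Longrightarrow> z < y \<Longrightarrow> f differentiable (at z)"
      using DERIV_interior(1)[OF D(1) i] real_differentiable_def by blast
    ultimately obtain l z where z: "x < z" "z < y" "(f has_real_derivative l) (at z)" "f y - f x = (y - x) * l"
      using MVT[OF xy(1)] by blast
    then have "l = deriv_on D f z" using DERIV_interior(1)[OF D(1) i] DERIV_unique by blast
    then have "\<bar>l\<bar> \<le> A" using deriv_on_le[OF D(1)] i[OF z(1,2)] interior_subset by blast
    then show ?thesis using z xy by (simp add: abs_mult mult.commute mult_left_mono)
  qed
  show ?thesis using *[of x y] *[of y x] D by (cases x y rule: linorder_cases) (auto simp: abs_minus_commute)
qed

text \<open>Since \<open>f 0 = 0\<close>, the right end of \<open>D0\<close> is mapped to 1, so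
  \<open>f\<close> increases on \<open>D0\<close>.\<close>

lemma branch0_mono:
  assumes "0 \<le> x" "x \<le> y" "y \<le> 1"
  shows "branch D0 x \<le> branch D0 y"
proof (rule ccontr)
  assume n: "\<not> branch D0 x \<le> branch D0 y"
  obtain s where s: "\<bar>s\<bar> = 1" and mono: "mono_on D0 (\<lambda>x. s * f x)" using mono_D[OF D0_G] .
  obtain a b where ab: "0 \<le> a" "a < b" "D0 = {a..b}" using interval[OF D0_G] by blast
  then have "a = 0" using zero_D0 by auto
  then have fb: "f b = 1" using endpoint_values[of a b] ab D0_G f_0 by auto
  have "s * f a \<le> s * f b" using mono ab unfolding monotone_on_def by auto
  then have "s = 1" using s fb f_0 \<open>a = 0\<close> by auto
  have xy: "f (branch D0 x) = x" "f (branch D0 y) = y" "branch D0 x \<in> D0" "branch D0 y \<in> D0"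
    using f_branch[OF D0_G] branch_in[OF D0_G] assms by auto
  have "s * f (branch D0 y) \<le> s * f (branch D0 x)"
    using monotone_onD[OF mono xy(4,3)] n by simp
  then have "x = y" using xy \<open>s = 1\<close> assms by simp
  with n show False by simp
qed

text \<open>The Lipschitz bound from the fixed point 0 gives x = f (branch D0 x) <= A * branch D0 x.
  Hence the cut points approach 0 at most geometrically.\<close>

lemma branch0_ge:
  assumes "0 \<le> x" "x \<le> 1"
  shows "x / A \<le> branch D0 x"
proof -
  have "branch D0 x \<in> D0" "f (branch D0 x) = x" using f_branch[OF D0_G] branch_in[OF D0_G] assms by auto
  moreover have "0 \<le> branch D0 x" using interval[OF D0_G] calculation(1) by auto
  ultimately show ?thesis using lipschitz[OF D0_G zero_D0, of "branch D0 x"] assms A f_0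
    by (simp add: field_simps)
qed

text \<open>Containing 0, the interval \<open>D0\<close> is the leftmost one, and
  \<open>branch D0 1\<close> belongs to it. Therefore truncation never removes a branch onto another
  interval.\<close>

lemma branch0_one_le:
  assumes "D \<in> G" "D \<noteq> D0" "x \<in> D"
  shows "branch D0 1 \<le> x"
proof -
  obtain a b where ab: "0 \<le> a" "a < b" "D0 = {a..b}" using interval[OF D0_G] by blast
  obtain d e where de: "0 \<le> d" "d < e" "D = {d..e}" using interval[OF assms(1)] by blast
  have "a = 0" using ab zero_D0 by auto
  have "b \<le> d"
  proof (rule ccontr)
    assume "\<not> b \<le> d"
    then have "(d + min b e) / 2 \<in> interior D \<inter> interior D0" using ab de \<open>a = 0\<close> by (auto simp: min_def)
    then show False using interior_disjoint[OF assms(1) D0_G assms(2)] by blast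
  qed
  then show ?thesis using branch_in[OF D0_G, of 1] ab de assms(3) by auto
qed

text \<open>On \<open>D1\<close> this is the Lipschitz bound from \<open>f 1 = 0\<close>. Any other
  interval lies to the left of \<open>D1\<close>, whose length is at least 1/A because
  \<open>f\<close> maps it onto [0,1].\<close>

lemma distance_from_one:
  assumes "x \<in> \<Union>G" "\<epsilon> \<le> f x" "\<epsilon> \<le> 1"
  shows "\<epsilon> / A \<le> 1 - x"
proof -
  obtain D where D: "D \<in> G" "x \<in> D" using assms(1) by blast
  have x1: "x \<le> 1" using interval[OF D(1)] D(2) by auto
  show ?thesis
  proof (cases "D = D1")
    case True
    then show ?thesis using lipschitz[OF D1_G one_D1, of x] D f_1 assms A x1 by (simp add: field_simps)
  next
    case False
    obtain a b where ab: "b \<le> 1" "a < b" "D1 = {a..b}" using interval[OF D1_G] by blast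
    obtain d e where de: "d < e" "D = {d..e}" "e \<le> 1" using interval[OF D(1)] by blast
    have "b = 1" using ab one_D1 by auto
    have "e \<le> a"
    proof (rule ccontr)
      assume "\<not> e \<le> a"
      then have "(e + max d a) / 2 \<in> interior D \<inter> interior D1" using ab de \<open>b = 1\<close> by (auto simp: max_def)
      then show False using interior_disjoint[OF D(1) D1_G False] by blast
    qed
    moreover have "f a = 1" using endpoint_values[of a b] ab D1_G f_1 \<open>b = 1\<close> by auto
    then have "1 \<le> A * (1 - a)" using lipschitz[OF D1_G one_D1, of a] ab f_1 \<open>b = 1\<close> by auto
    then have "\<epsilon> / A \<le> 1 - a" using assms A by (simp add: field_simps)
    ultimately show ?thesis using D de by auto
  qed
qed

end

section \<open>Truncated systems and their transfer operators\<close>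

locale random_system =
  fixes M :: "'w measure" and \<theta> :: "'w \<Rightarrow> 'w" and T :: "'w \<Rightarrow> real \<Rightarrow> real"
    and GC GE :: "real set set" and D0 D1 :: "real set" and \<kappa> A :: real
    and \<gamma> :: "real set \<Rightarrow> nat" and c v :: "real set \<Rightarrow> real"
  assumes random_map: "random_critically_finite_map M \<theta> T GC GE D0 D1 \<kappa> A \<gamma> c v"
begin

abbreviation "G \<equiv> GC \<union> GE"
abbreviation "J \<equiv> trunc_julia \<theta> T G D0"
abbreviation "p m \<omega> \<equiv> pullback0 \<theta> T D0 m \<omega> 1"
abbreviation "br \<omega> \<equiv> inverse_branch (T \<omega>)"
abbreviation "wt \<omega> \<equiv> branch_weight (T \<omega>)"

text \<open>A lower bound for the distance of the \<open>k\<close>-th truncated system from both 0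
  and 1: \<open>k\<close> factors for the \<open>k\<close> inverse steps that define the cut point
  near 0, one more because points near 1 are mapped near 0.\<close>

definition \<epsilon> :: "nat \<Rightarrow> real" where
  "\<epsilon> k = (1 / A) ^ Suc k"

lemma A_gt_1: "1 < A"
  using random_map by (simp add: random_critically_finite_map_def)

lemma \<epsilon>_pos: "0 < \<epsilon> k"
  using A_gt_1 by (simp add: \<epsilon>_def)

lemma map_T: "\<omega> \<in> space M \<Longrightarrow> critically_finite_map (T \<omega>) GC GE D0 D1 \<kappa> A \<gamma> c v"
  using random_map by (simp add: random_critically_finite_map_def critically_finite_map_def)

lemma \<theta>_measurable: "\<theta> \<in> measurable M M" and \<theta>_distr: "distr M M \<theta> = M" and prob: "prob_space M"
  using random_map by (simp_all add: random_critically_finite_map_def ergodic_automorphism_def)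

lemma \<theta>_space: "\<omega> \<in> space M \<Longrightarrow> \<theta> \<omega> \<in> space M"
  using \<theta>_measurable by (rule measurable_space)

lemma \<theta>n_space: "\<omega> \<in> space M \<Longrightarrow> (\<theta> ^^ n) \<omega> \<in> space M"
  by (induction n) (auto intro: \<theta>_space)

lemma space_nonempty: "space M \<noteq> {}"
  using prob by (rule prob_space.not_empty)

lemma finite_G: "finite G" and D0_G: "D0 \<in> G" and D1_G: "D1 \<in> G" and D1_neq_D0: "D1 \<noteq> D0"
  using critically_finite_map.finite_G critically_finite_map.D0_G critically_finite_map.D1_G
    critically_finite_map.D0_neq_D1 map_T space_nonempty by (metis ex_in_conv)+

section \<open>Cut points of the truncation\<close>

lemma p_Suc: "p (Suc m) \<omega> = br \<omega> D0 (p m (\<theta> \<omega>))"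
  by (simp add: inverse_branch_def)

lemma p_bounds:
  assumes "\<omega> \<in> space M"
  shows "(1 / A) ^ m \<le> p m \<omega> \<and> p m \<omega> \<le> 1"
  using assms
proof (induction m arbitrary: \<omega>)
  case 0
  then show ?case by simp
next
  case (Suc m)
  interpret f: critically_finite_map "T \<omega>" GC GE D0 D1 \<kappa> A \<gamma> c v using map_T Suc.prems .
  have IH: "(1 / A) ^ m \<le> p m (\<theta> \<omega>)" "p m (\<theta> \<omega>) \<le> 1" using Suc.IH[OF \<theta>_space] Suc.prems by auto
  have pos: "0 < (1 / A) ^ m" using A_gt_1 by simp
  have "p m (\<theta> \<omega>) / A \<le> br \<omega> D0 (p m (\<theta> \<omega>))" using IH pos by (intro f.branch0_ge) auto
  moreover have "(1 / A) ^ Suc m \<le> p m (\<theta> \<omega>) / A" using IH(1) A_gt_1 by (simp add: divide_right_mono)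
  moreover have "br \<omega> D0 (p m (\<theta> \<omega>)) \<in> D0" using IH pos by (intro f.branch_in D0_G) auto
  then have "br \<omega> D0 (p m (\<theta> \<omega>)) \<le> 1" using f.interval[OF D0_G] by auto
  ultimately show ?case unfolding p_Suc by linarith
qed

lemma p_pos: "\<omega> \<in> space M \<Longrightarrow> 0 < p m \<omega>"
  using p_bounds[of \<omega> m] A_gt_1 by (smt (verit) divide_pos_pos zero_less_power)

lemma p_Suc_le:
  assumes "\<omega> \<in> space M"
  shows "p (Suc m) \<omega> \<le> p m \<omega>"
  using assms
proof (induction m arbitrary: \<omega>)
  case 0
  then show ?case using p_bounds[of \<omega> 1] by simp
next
  case (Suc m)
  interpret f: critically_finite_map "T \<omega>" GC GE D0 D1 \<kappa> A \<gamma> c v using map_T Suc.prems .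
  have "p (Suc m) (\<theta> \<omega>) \<le> p m (\<theta> \<omega>)" using Suc.IH[OF \<theta>_space] Suc.prems by auto
  moreover have "0 \<le> p (Suc m) (\<theta> \<omega>)" "p m (\<theta> \<omega>) \<le> 1"
    using p_bounds p_pos \<theta>_space[OF Suc.prems] by (blast intro: less_imp_le)+
  ultimately show ?case unfolding p_Suc[of "Suc m"] p_Suc[of m \<omega>] by (intro f.branch0_mono)
qed

lemma p_antimono:
  assumes "\<omega> \<in> space M" "m \<le> n"
  shows "p n \<omega> \<le> p m \<omega>"
  by (rule lift_Suc_antimono_le[where f = "\<lambda>m. p m \<omega>", OF p_Suc_le[OF assms(1)] assms(2)])

section \<open>Fibres of the truncated system\<close>

lemma cocycle_Suc_shift: "cocycle \<theta> T (Suc n) \<omega> x = cocycle \<theta> T n (\<theta> \<omega>) (T \<omega> x)"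
  by (induction n) (auto simp: funpow_swap1)

lemma J_iff:
  "x \<in> J k \<omega> \<longleftrightarrow> x \<in> \<Union>G \<and> p k \<omega> \<le> x \<and> x \<le> 1 \<and> T \<omega> x \<in> J k (\<theta> \<omega>)" (is "_ \<longleftrightarrow> ?R")
proof -
  have split: "(\<forall>n. Q n) \<longleftrightarrow> Q 0 \<and> (\<forall>n. Q (Suc n))" for Q :: "nat \<Rightarrow> bool"
    by (metis nat.exhaust)
  have "x \<in> J k \<omega> \<longleftrightarrow> (\<forall>n. cocycle \<theta> T n \<omega> x \<in> \<Union>G \<inter> trunc_interval \<theta> T D0 k ((\<theta> ^^ n) \<omega>))"
    by (simp only: trunc_julia_def mem_Collect_eq)
  also have "\<dots> \<longleftrightarrow> cocycle \<theta> T 0 \<omega> x \<in> \<Union>G \<inter> trunc_interval \<theta> T D0 k ((\<theta> ^^ 0) \<omega>) \<and>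
      (\<forall>n. cocycle \<theta> T (Suc n) \<omega> x \<in> \<Union>G \<inter> trunc_interval \<theta> T D0 k ((\<theta> ^^ Suc n) \<omega>))"
    by (rule split)
  also have "\<dots> \<longleftrightarrow> ?R"
    unfolding cocycle_Suc_shift funpow_Suc_right o_apply
    by (simp add: trunc_interval_def trunc_julia_def)
  finally show ?thesis .
qed

text \<open>The distance from 0 comes from the cut point at \<open>\<omega>\<close>. The distance
  from 1 comes from the cut point at \<open>\<theta> \<omega>\<close>: the image of \<open>x\<close>
  stays to its right, and \<open>distance_from_one\<close> applies.\<close>

lemma J_bounds:
  assumes "\<omega> \<in> space M" "x \<in> J k \<omega>"
  shows "\<epsilon> k \<le> x" "\<epsilon> k \<le> 1 - x" "0 < x" "x < 1"
proof -
  interpret f: critically_finite_map "T \<omega>" GC GE D0 D1 \<kappa> A \<gamma> c v using map_T assms(1) .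
  have le: "(1 / A) ^ k \<le> 1" using A_gt_1 by (intro power_le_one) auto
  have "\<epsilon> k \<le> (1 / A) ^ k" unfolding \<epsilon>_def using A_gt_1 by (intro power_decreasing) auto
  also have "\<dots> \<le> x" using p_bounds[OF assms(1), of k] assms(2) J_iff[of x] by auto
  finally show 1: "\<epsilon> k \<le> x" .
  have "(1 / A) ^ k \<le> T \<omega> x"
    using p_bounds[OF \<theta>_space[OF assms(1)], of k] assms(2) J_iff[of x k \<omega>] J_iff[of "T \<omega> x" k "\<theta> \<omega>"] by auto
  then have "(1 / A) ^ k / A \<le> 1 - x"
    using assms(2) J_iff[of x k \<omega>] le by (intro f.distance_from_one) auto
  then show 2: "\<epsilon> k \<le> 1 - x" by (simp add: \<epsilon>_def)
  show "0 < x" "x < 1" using 1 2 \<epsilon>_pos[of k] by linarith+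
qed

text \<open>After \<open>m\<close> steps the orbit of \<open>p m \<omega>\<close> reaches 1, which
  is in no truncated fibre. So the inequality that defines the cut is never an equality on a fibre;
  this gives continuity of the truncated operator and rigidity of admissible words.\<close>

lemma p_notin_J: "\<omega> \<in> space M \<Longrightarrow> p m \<omega> \<notin> J k \<omega>"
proof (induction m arbitrary: \<omega>)
  case 0
  then show ?case using J_bounds(4) by fastforce
next
  case (Suc m)
  interpret f: critically_finite_map "T \<omega>" GC GE D0 D1 \<kappa> A \<gamma> c v using map_T Suc.prems .
  have s: "\<theta> \<omega> \<in> space M" using \<theta>_space Suc.prems .
  have "T \<omega> (p (Suc m) \<omega>) = p m (\<theta> \<omega>)"
    unfolding p_Suc using p_bounds[OF s, of m] p_pos[OF s, of m] by (intro f.f_branch D0_G) auto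
  then show ?case using Suc.IH[OF s] J_iff by metis
qed

text \<open>The conditions up to time \<open>n\<close> define closed sets by induction, because
  \<open>T \<omega>\<close> is continuous on a closed domain; the fibre is their intersection.
  Closedness serves to make fibres measurable.\<close>

lemma closed_J:
  assumes "\<omega> \<in> space M"
  shows "closed (J k \<omega>)"
proof -
  define C where "C n \<omega> = {x. \<forall>j<n. cocycle \<theta> T j \<omega> x \<in> \<Union>G \<inter> trunc_interval \<theta> T D0 k ((\<theta> ^^ j) \<omega>)}" for n \<omega>
  have "closed (C n \<omega>)" for n using assms
  proof (induction n arbitrary: \<omega>)
    case 0
    then show ?case by (simp add: C_def)
  next
    case (Suc n)
    interpret f: critically_finite_map "T \<omega>" GC GE D0 D1 \<kappa> A \<gamma> c v using map_T Suc.prems .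
    have "C (Suc n) \<omega> = (\<Union>G \<inter> {p k \<omega>..1}) \<inter> (T \<omega> -` C n (\<theta> \<omega>))"
      unfolding C_def All_less_Suc2 cocycle_Suc_shift funpow_Suc_right o_apply
      by (auto simp: trunc_interval_def)
    moreover have "closed (\<Union>G \<inter> {p k \<omega>..1})"
    proof (intro closed_Int closed_Union finite_G closed_atLeastAtMost ballI)
      fix D assume "D \<in> G"
      from f.interval[OF this] show "closed D" by auto
    qed
    ultimately show ?case
      using continuous_closed_preimage[OF continuous_on_subset[OF f.cont Int_lower1]]
        Suc.IH[OF \<theta>_space[OF Suc.prems]] by metis
  qed
  moreover have "J k \<omega> = (\<Inter>n. C n \<omega>)"
    unfolding C_def trunc_julia_def by auto
  ultimately show ?thesis by auto
qed

section \<open>Transfer operators as sums over branches\<close>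

lemma br_in_J_iff:
  assumes "\<omega> \<in> space M" "D \<in> G" "x \<in> J k (\<theta> \<omega>)"
  shows "br \<omega> D x \<in> J k \<omega> \<longleftrightarrow> p k \<omega> \<le> br \<omega> D x"
proof -
  interpret f: critically_finite_map "T \<omega>" GC GE D0 D1 \<kappa> A \<gamma> c v using map_T assms(1) .
  have x: "0 < x" "x < 1" using J_bounds(3,4)[OF \<theta>_space[OF assms(1)] assms(3)] .
  then show ?thesis
    using J_iff[of "br \<omega> D x" k \<omega>] f.branch_in[OF assms(2), of x] f.f_branch[OF assms(2), of x]
      f.branch_unit_interval[OF assms(2) x] assms by auto
qed

text \<open>Every preimage is the value of exactly one branch. The index set \<open>G\<close> no
  longer depends on \<open>x\<close>, so regularity can be checked one summand at a time.\<close>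

lemma transfer_op_eq:
  assumes "\<omega> \<in> space M" "x \<in> J k (\<theta> \<omega>)"
  shows "transfer_op \<theta> T G D0 t k \<omega> g x =
    (\<Sum>D\<in>G. if br \<omega> D x \<in> J k \<omega> then g (br \<omega> D x) * (wt \<omega> D x)\<^sup>2 powr (- t) else 0)"
proof -
  interpret f: critically_finite_map "T \<omega>" GC GE D0 D1 \<kappa> A \<gamma> c v using map_T assms(1) .
  have x: "0 < x" "x < 1" using J_bounds(3,4)[OF \<theta>_space[OF assms(1)] assms(2)] .
  have eq: "{y \<in> J k \<omega>. T \<omega> y = x} = (\<lambda>D. br \<omega> D x) ` {D\<in>G. br \<omega> D x \<in> J k \<omega>}"
  proof (intro set_eqI iffI)
    fix y assume y: "y \<in> {y \<in> J k \<omega>. T \<omega> y = x}"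
    then obtain D where "D \<in> G" "y \<in> D" using J_iff[of y k \<omega>] by auto
    then show "y \<in> (\<lambda>D. br \<omega> D x) ` {D\<in>G. br \<omega> D x \<in> J k \<omega>}"
      using f.branch_f[of D y] y by (intro image_eqI[where x = D]) auto
  next
    fix y assume "y \<in> (\<lambda>D. br \<omega> D x) ` {D\<in>G. br \<omega> D x \<in> J k \<omega>}"
    then show "y \<in> {y \<in> J k \<omega>. T \<omega> y = x}" using f.f_branch[of _ x] x by auto
  qed
  have inj: "inj_on (\<lambda>D. br \<omega> D x) {D\<in>G. br \<omega> D x \<in> J k \<omega>}"
    using f.branch_inject x by (auto simp: inj_on_def)
  have "transfer_op \<theta> T G D0 t k \<omega> g x =
     (\<Sum>D\<in>{D\<in>G. br \<omega> D x \<in> J k \<omega>}. g (br \<omega> D x) * \<bar>deriv (T \<omega>) (br \<omega> D x)\<bar> powr (- t))"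
    unfolding transfer_op_def eq sum.reindex[OF inj] by simp
  also have "\<dots> = (\<Sum>D\<in>{D\<in>G. br \<omega> D x \<in> J k \<omega>}. g (br \<omega> D x) * (wt \<omega> D x)\<^sup>2 powr (- t))"
    by (simp add: branch_weight_def)
  also have "\<dots> = (\<Sum>D\<in>G. if br \<omega> D x \<in> J k \<omega> then g (br \<omega> D x) * (wt \<omega> D x)\<^sup>2 powr (- t) else 0)"
    using finite_G by (intro sum.inter_filter) auto
  finally show ?thesis .
qed

text \<open>Duality with the conformal measures is given for continuous functions only, so iteration
  must preserve continuity. A summand could jump only where its branch crosses
  \<open>p k \<omega>\<close>, and by \<open>p_notin_J\<close> equality never occurs there; the
  matching condition for the two pieces is vacuous.\<close>

lemma continuous_transfer_op:
  assumes "\<omega> \<in> space M" "continuous_on (J k \<omega>) g"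
  shows "continuous_on (J k (\<theta> \<omega>)) (transfer_op \<theta> T G D0 t k \<omega> g)"
proof -
  interpret f: critically_finite_map "T \<omega>" GC GE D0 D1 \<kappa> A \<gamma> c v using map_T assms(1) .
  note x = J_bounds(3,4)[OF \<theta>_space[OF assms(1)], where k = k]
  have "continuous_on (J k (\<theta> \<omega>)) (\<lambda>x. if br \<omega> D x \<in> J k \<omega> then g (br \<omega> D x) * (wt \<omega> D x)\<^sup>2 powr (- t) else 0)"
    if D: "D \<in> G" for D
  proof -
    note cb = concave_branchD[OF f.concave_branch_branch[OF D]]
    have c: "continuous_on (J k (\<theta> \<omega>)) (br \<omega> D)"
      using cb(4) x by (intro continuous_at_imp_continuous_on) auto
    have w: "continuous_on (J k (\<theta> \<omega>)) (\<lambda>x. (wt \<omega> D x)\<^sup>2 powr (- t))"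
      using cb(3,5) x
      by (intro continuous_at_imp_continuous_on ballI continuous_intros) (force simp: less_le)+
    have "continuous_on (J k (\<theta> \<omega>))
        (\<lambda>x. if br \<omega> D x \<le> p k \<omega> then 0 else g (br \<omega> D x) * (wt \<omega> D x)\<^sup>2 powr (- t))"
    proof (rule continuous_on_cases_le[OF _ _ c])
      have "continuous_on {x \<in> J k (\<theta> \<omega>). p k \<omega> \<le> br \<omega> D x} (\<lambda>x. g (br \<omega> D x))"
        using br_in_J_iff[OF assms(1) D]
        by (intro continuous_on_compose2[OF assms(2) continuous_on_subset[OF c]]) auto
      then show "continuous_on {x \<in> J k (\<theta> \<omega>). p k \<omega> \<le> br \<omega> D x} (\<lambda>x. g (br \<omega> D x) * (wt \<omega> D x)\<^sup>2 powr (- t))"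
        by (intro continuous_on_mult continuous_on_subset[OF w]) auto
      show "0 = g (br \<omega> D x) * (wt \<omega> D x)\<^sup>2 powr (- t)"
        if "x \<in> J k (\<theta> \<omega>)" "br \<omega> D x = p k \<omega>" for x
        using br_in_J_iff[OF assms(1) D that(1)] p_notin_J[OF assms(1)] that(2) by (metis order_refl)
    qed simp
    then show ?thesis
      by (rule continuous_on_eq)
         (use br_in_J_iff[OF assms(1) D] p_notin_J[OF assms(1)] in \<open>force simp: not_le less_le\<close>)
  qed
  then have "continuous_on (J k (\<theta> \<omega>)) (\<lambda>x. \<Sum>D\<in>G. if br \<omega> D x \<in> J k \<omega> then g (br \<omega> D x) * (wt \<omega> D x)\<^sup>2 powr (- t) else 0)"
    by (rule continuous_on_sum)
  then show ?thesis
    by (rule continuous_on_eq) (use transfer_op_eq[OF assms(1)] in auto)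
qed

end

section \<open>Iterated transfer operators\<close>

context random_system
begin

text \<open>Words are read backwards in time: the head of the list is the last interval visited.\<close>

primrec word_branch :: "'w \<Rightarrow> real set list \<Rightarrow> real \<Rightarrow> real" where
  "word_branch \<omega> [] x = x"
| "word_branch \<omega> (D # w) x = word_branch \<omega> w (br ((\<theta> ^^ length w) \<omega>) D x)"

primrec word_weight :: "'w \<Rightarrow> real set list \<Rightarrow> real \<Rightarrow> real" where
  "word_weight \<omega> [] x = 1"
| "word_weight \<omega> (D # w) x =
     word_weight \<omega> w (br ((\<theta> ^^ length w) \<omega>) D x) * wt ((\<theta> ^^ length w) \<omega>) D x"

definition words :: "nat \<Rightarrow> real set list set" where
  "words n = {w. set w \<subseteq> G \<and> length w = n}"

lemma words_0: "words 0 = {[]}"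
  by (auto simp: words_def)

lemma words_Suc: "words (Suc n) = (\<lambda>(D, w). D # w) ` (G \<times> words n)"
  unfolding words_def by (auto simp: length_Suc_conv image_iff)

lemma concave_branch_word:
  assumes "\<omega> \<in> space M" "set w \<subseteq> G"
  shows "concave_branch (word_branch \<omega> w) (word_weight \<omega> w)"
  using assms(2)
proof (induction w)
  case Nil
  have "word_branch \<omega> [] = (\<lambda>x. x)" "word_weight \<omega> [] = (\<lambda>x. 1)" by auto
  then show ?case using concave_branch_id by simp
next
  case (Cons D w)
  interpret f: critically_finite_map "T ((\<theta> ^^ length w) \<omega>)" GC GE D0 D1 \<kappa> A \<gamma> c v
    using map_T \<theta>n_space assms(1) by simp
  have "word_branch \<omega> (D # w) = (\<lambda>x. word_branch \<omega> w (br ((\<theta> ^^ length w) \<omega>) D x))"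
    "word_weight \<omega> (D # w) = (\<lambda>x. word_weight \<omega> w (br ((\<theta> ^^ length w) \<omega>) D x) * wt ((\<theta> ^^ length w) \<omega>) D x)"
    by auto
  then show ?case using concave_branch_compose[OF _ f.concave_branch_branch] Cons by simp
qed

text \<open>By the chain rule the squared weight is a product of \<open>length w\<close>
  derivatives, each at most \<open>A\<close>.\<close>

lemma word_weight_le:
  assumes "\<omega> \<in> space M" "set w \<subseteq> G" "0 < x" "x < 1"
  shows "(word_weight \<omega> w x)\<^sup>2 \<le> A ^ length w"
  using assms(2-)
proof (induction w arbitrary: x)
  case Nil
  then show ?case by simp
next
  case (Cons D w)
  interpret f: critically_finite_map "T ((\<theta> ^^ length w) \<omega>)" GC GE D0 D1 \<kappa> A \<gamma> c v
    using map_T \<theta>n_space assms(1) by simp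
  let ?y = "br ((\<theta> ^^ length w) \<omega>) D x"
  have D: "D \<in> G" using Cons.prems by simp
  have "(word_weight \<omega> w ?y)\<^sup>2 \<le> A ^ length w"
    using Cons f.branch_unit_interval[OF D] by simp
  moreover have "(wt ((\<theta> ^^ length w) \<omega>) D x)\<^sup>2 \<le> A" using f.weight_le[OF D] Cons.prems by simp
  ultimately have "(word_weight \<omega> w ?y)\<^sup>2 * (wt ((\<theta> ^^ length w) \<omega>) D x)\<^sup>2 \<le> A ^ length w * A"
    using A_gt_1 by (intro mult_mono) auto
  then show ?case by (simp add: power_mult_distrib mult.commute)
qed

lemma word_branch_J:
  assumes "\<omega> \<in> space M" "set w \<subseteq> G" "0 < x" "x < 1" "word_branch \<omega> w x \<in> J k \<omega>"
  shows "x \<in> J k ((\<theta> ^^ length w) \<omega>)"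
  using assms(2-)
proof (induction w arbitrary: x)
  case Nil
  then show ?case by simp
next
  case (Cons D w)
  interpret f: critically_finite_map "T ((\<theta> ^^ length w) \<omega>)" GC GE D0 D1 \<kappa> A \<gamma> c v
    using map_T \<theta>n_space assms(1) by simp
  let ?y = "br ((\<theta> ^^ length w) \<omega>) D x"
  have D: "D \<in> G" using Cons.prems by simp
  have "?y \<in> J k ((\<theta> ^^ length w) \<omega>)" using Cons f.branch_unit_interval[OF D] by simp
  then have "T ((\<theta> ^^ length w) \<omega>) ?y \<in> J k (\<theta> ((\<theta> ^^ length w) \<omega>))" using J_iff by blast
  then show ?case using f.f_branch[OF D] Cons.prems by simp
qed

text \<open>The iterated operator applied to 1, started in the fibre over \<open>\<omega>\<close>;
  the result is meaningful on the fibre over \<open>(\<theta> ^^ n) \<omega>\<close>.\<close>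

primrec iter :: "real \<Rightarrow> nat \<Rightarrow> nat \<Rightarrow> 'w \<Rightarrow> real \<Rightarrow> real" where
  "iter t k 0 \<omega> = (\<lambda>_. 1)"
| "iter t k (Suc n) \<omega> = transfer_op \<theta> T G D0 t k ((\<theta> ^^ n) \<omega>) (iter t k n \<omega>)"

lemma continuous_iter:
  assumes "\<omega> \<in> space M"
  shows "continuous_on (J k ((\<theta> ^^ n) \<omega>)) (iter t k n \<omega>)"
proof (induction n)
  case (Suc n)
  then show ?case using continuous_transfer_op[OF \<theta>n_space[OF assms], of k n "iter t k n \<omega>" t] by simp
qed simp

text \<open>It suffices to test the final point of a word: by forward invariance of the fibres
  (\<open>word_branch_J\<close>), all intermediate points lie in their fibres as well.\<close>

lemma iter_eq:
  assumes "\<omega> \<in> space M" "x \<in> J k ((\<theta> ^^ n) \<omega>)"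
  shows "iter t k n \<omega> x =
    (\<Sum>w\<in>words n. if word_branch \<omega> w x \<in> J k \<omega> then (word_weight \<omega> w x)\<^sup>2 powr (- t) else 0)"
  using assms(2)
proof (induction n arbitrary: x)
  case 0
  then show ?case by (simp add: words_0)
next
  case (Suc n)
  let ?\<sigma> = "(\<theta> ^^ n) \<omega>"
  have \<sigma>: "?\<sigma> \<in> space M" using \<theta>n_space assms(1) .
  interpret f: critically_finite_map "T ?\<sigma>" GC GE D0 D1 \<kappa> A \<gamma> c v using map_T \<sigma> .
  have xJ: "x \<in> J k (\<theta> ?\<sigma>)" using Suc.prems by simp
  have x: "0 < x" "x < 1" using J_bounds(3,4)[OF \<theta>_space[OF \<sigma>] xJ] .
  have "iter t k (Suc n) \<omega> x = (\<Sum>D\<in>G. if br ?\<sigma> D x \<in> J k ?\<sigma> then iter t k n \<omega> (br ?\<sigma> D x) * (wt ?\<sigma> D x)\<^sup>2 powr (- t) else 0)"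
    using transfer_op_eq[OF \<sigma> xJ] by simp
  also have "\<dots> = (\<Sum>D\<in>G. \<Sum>w\<in>words n. if word_branch \<omega> (D # w) x \<in> J k \<omega>
       then (word_weight \<omega> (D # w) x)\<^sup>2 powr (- t) else 0)"
  proof (rule sum.cong[OF refl])
    fix D assume D: "D \<in> G"
    note y = f.branch_unit_interval[OF D x]
    show "(if br ?\<sigma> D x \<in> J k ?\<sigma> then iter t k n \<omega> (br ?\<sigma> D x) * (wt ?\<sigma> D x)\<^sup>2 powr (- t) else 0) =
      (\<Sum>w\<in>words n. if word_branch \<omega> (D # w) x \<in> J k \<omega>
       then (word_weight \<omega> (D # w) x)\<^sup>2 powr (- t) else 0)"
    proof (cases "br ?\<sigma> D x \<in> J k ?\<sigma>")
      case True
      have "iter t k n \<omega> (br ?\<sigma> D x) * (wt ?\<sigma> D x)\<^sup>2 powr (- t) =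
        (\<Sum>w\<in>words n. (if word_branch \<omega> w (br ?\<sigma> D x) \<in> J k \<omega> then (word_weight \<omega> w (br ?\<sigma> D x))\<^sup>2 powr (- t) else 0)
          * (wt ?\<sigma> D x)\<^sup>2 powr (- t))"
        unfolding Suc.IH[OF True] by (rule sum_distrib_right)
      also have "\<dots> = (\<Sum>w\<in>words n. if word_branch \<omega> (D # w) x \<in> J k \<omega>
       then (word_weight \<omega> (D # w) x)\<^sup>2 powr (- t) else 0)"
        by (intro sum.cong refl) (auto simp: words_def power_mult_distrib powr_mult)
      finally show ?thesis using True by simp
    next
      case False
      have "word_branch \<omega> (D # w) x \<notin> J k \<omega>" if "w \<in> words n" for w
        using word_branch_J[OF assms(1) _ y, of w k] False that by (auto simp: words_def)
      then show ?thesis using False by simp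
    qed
  qed
  also have "\<dots> = (\<Sum>w\<in>words (Suc n). if word_branch \<omega> w x \<in> J k \<omega> then (word_weight \<omega> w x)\<^sup>2 powr (- t) else 0)"
    unfolding words_Suc sum.cartesian_product
    by (subst sum.reindex) (auto simp: inj_on_def intro!: sum.cong)
  finally show ?case .
qed

lemma iter_nonneg:
  assumes "\<omega> \<in> space M" "x \<in> J k ((\<theta> ^^ n) \<omega>)"
  shows "0 \<le> iter t k n \<omega> x"
  unfolding iter_eq[OF assms] by (intro sum_nonneg) auto

text \<open>This is how critical points are controlled: only the distance of \<open>x\<close> from 0
  and 1 enters, whatever the length of the word and whether or not it is admissible.\<close>

lemma word_weight_ge:
  assumes "\<omega> \<in> space M" "set w \<subseteq> G" "x \<in> J k ((\<theta> ^^ length w) \<omega>)"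
  shows "\<epsilon> k / 4 \<le> word_weight \<omega> w x"
proof -
  note b = J_bounds[OF \<theta>n_space[OF assms(1)] assms(3)]
  have "\<epsilon> k / 4 \<le> min x (1 - x) / 4" using b by simp
  also have "\<dots> \<le> word_weight \<omega> w x"
    using concave_branch_lower_bound[OF concave_branch_word[OF assms(1,2)]] b by simp
  finally show ?thesis .
qed

text \<open>A crude count of words, applied with one step to bound the eigenvalue from
  above.\<close>

lemma iter_le:
  assumes "\<omega> \<in> space M" "x \<in> J k ((\<theta> ^^ n) \<omega>)" "0 \<le> t"
  shows "iter t k n \<omega> x \<le> real (card (words n)) * ((\<epsilon> k / 4)\<^sup>2) powr (- t)"
  unfolding iter_eq[OF assms(1,2)]
proof (rule sum_bounded_above)
  fix w assume w: "w \<in> words n"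
  have "\<epsilon> k / 4 \<le> word_weight \<omega> w x" using word_weight_ge[OF assms(1)] w assms(2) by (auto simp: words_def)
  then have "(\<epsilon> k / 4)\<^sup>2 \<le> (word_weight \<omega> w x)\<^sup>2" using \<epsilon>_pos[of k] by (intro power_mono) auto
  then show "(if word_branch \<omega> w x \<in> J k \<omega> then (word_weight \<omega> w x)\<^sup>2 powr (- t) else 0)
      \<le> ((\<epsilon> k / 4)\<^sup>2) powr (- t)"
    using \<epsilon>_pos[of k] assms(3) by (auto intro!: powr_mono2')
qed

lemma D1_branch_in_J:
  assumes "\<omega> \<in> space M" "1 \<le> k" "x \<in> J k (\<theta> \<omega>)"
  shows "br \<omega> D1 x \<in> J k \<omega>" "p 1 \<omega> \<le> br \<omega> D1 x"
proof -
  interpret f: critically_finite_map "T \<omega>" GC GE D0 D1 \<kappa> A \<gamma> c v using map_T assms(1) .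
  have x: "0 < x" "x < 1" using J_bounds(3,4)[OF \<theta>_space[OF assms(1)] assms(3)] .
  have "f.branch D0 1 \<le> br \<omega> D1 x" using f.branch_in[OF D1_G] x
    by (intro f.branch0_one_le[OF D1_G D1_neq_D0]) auto
  then show 1: "p 1 \<omega> \<le> br \<omega> D1 x" by (simp add: inverse_branch_def)
  then show "br \<omega> D1 x \<in> J k \<omega>"
    unfolding br_in_J_iff[OF assms(1) D1_G assms(3)] using p_antimono[OF assms(1,2)] by linarith
qed

text \<open>Of the sum over \<open>G\<close> only the term of \<open>D1\<close> is kept; it is
  always present, and its derivative is at most \<open>A\<close>.\<close>

lemma iter_Suc_ge:
  assumes "\<omega> \<in> space M" "1 \<le> k" "0 \<le> t" "x \<in> J k ((\<theta> ^^ Suc n) \<omega>)"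
  shows "A powr (- t) * iter t k n \<omega> (br ((\<theta> ^^ n) \<omega>) D1 x) \<le> iter t k (Suc n) \<omega> x"
proof -
  let ?\<sigma> = "(\<theta> ^^ n) \<omega>"
  have \<sigma>: "?\<sigma> \<in> space M" using \<theta>n_space assms(1) .
  interpret f: critically_finite_map "T ?\<sigma>" GC GE D0 D1 \<kappa> A \<gamma> c v using map_T \<sigma> .
  have xJ: "x \<in> J k (\<theta> ?\<sigma>)" using assms(4) by simp
  have x: "0 < x" "x < 1" using J_bounds(3,4)[OF \<theta>_space[OF \<sigma>] xJ] .
  have y: "br ?\<sigma> D1 x \<in> J k ?\<sigma>" using D1_branch_in_J(1)[OF \<sigma> assms(2) xJ] .
  have pos: "0 < (wt ?\<sigma> D1 x)\<^sup>2"
    using concave_branchD(3)[OF f.concave_branch_branch[OF D1_G] x] by simp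
  have "A powr (- t) \<le> (wt ?\<sigma> D1 x)\<^sup>2 powr (- t)"
    using f.weight_le[OF D1_G x] pos assms(3) by (intro powr_mono2') auto
  then have "A powr (- t) * iter t k n \<omega> (br ?\<sigma> D1 x) \<le> iter t k n \<omega> (br ?\<sigma> D1 x) * (wt ?\<sigma> D1 x)\<^sup>2 powr (- t)"
    using iter_nonneg[OF assms(1) y] by (metis mult.commute mult_right_mono)
  also have "\<dots> = (if br ?\<sigma> D1 x \<in> J k ?\<sigma> then iter t k n \<omega> (br ?\<sigma> D1 x) * (wt ?\<sigma> D1 x)\<^sup>2 powr (- t) else 0)"
    using y by simp
  also have "\<dots> \<le> (\<Sum>D\<in>G. if br ?\<sigma> D x \<in> J k ?\<sigma> then iter t k n \<omega> (br ?\<sigma> D x) * (wt ?\<sigma> D x)\<^sup>2 powr (- t) else 0)"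
  proof (rule member_le_sum[OF D1_G _ finite_G])
    show "0 \<le> (if br ?\<sigma> D x \<in> J k ?\<sigma> then iter t k n \<omega> (br ?\<sigma> D x) * (wt ?\<sigma> D x)\<^sup>2 powr (- t) else 0)" for D
      using iter_nonneg[OF assms(1), of "br ?\<sigma> D x" k n t] by simp
  qed
  also have "\<dots> = iter t k (Suc n) \<omega> x" using transfer_op_eq[OF \<sigma> xJ] by simp
  finally show ?thesis .
qed

text \<open>The truncation restricts only the branch onto \<^term>\<open>D0\<close>, which maps \<open>p m (\<theta> \<omega>)\<close> to \<open>p (Suc m) \<omega>\<close>; so the
  hypothesis on the positions relative to the points \<open>p m\<close> is inherited by the preimages.\<close>

lemma word_admissible:
  assumes "\<omega> \<in> space M" "k \<le> k'" "set w \<subseteq> G"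
    and "x \<in> J k ((\<theta> ^^ length w) \<omega>)" "y \<in> J k' ((\<theta> ^^ length w) \<omega>)"
    and "\<And>m. m \<le> k \<Longrightarrow> p m ((\<theta> ^^ length w) \<omega>) \<le> x \<Longrightarrow> p m ((\<theta> ^^ length w) \<omega>) \<le> y"
    and "word_branch \<omega> w x \<in> J k \<omega>"
  shows "word_branch \<omega> w y \<in> J k' \<omega>"
  using assms(3-)
proof (induction w arbitrary: x y)
  case Nil
  then show ?case by simp
next
  case (Cons D w)
  let ?\<sigma> = "(\<theta> ^^ length w) \<omega>"
  have \<sigma>: "?\<sigma> \<in> space M" using \<theta>n_space assms(1) .
  interpret f: critically_finite_map "T ?\<sigma>" GC GE D0 D1 \<kappa> A \<gamma> c v using map_T \<sigma> .
  have D: "D \<in> G" and w: "set w \<subseteq> G" using Cons.prems by auto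
  have xJ: "x \<in> J k (\<theta> ?\<sigma>)" and yJ: "y \<in> J k' (\<theta> ?\<sigma>)" using Cons.prems by auto
  have x: "0 < x" "x < 1" using J_bounds(3,4)[OF \<theta>_space[OF \<sigma>] xJ] .
  have y: "0 < y" "y < 1" using J_bounds(3,4)[OF \<theta>_space[OF \<sigma>] yJ] .
  note x' = f.branch_unit_interval[OF D x]
  have wx: "word_branch \<omega> w (br ?\<sigma> D x) \<in> J k \<omega>" using Cons.prems(5) by simp
  have x'J: "br ?\<sigma> D x \<in> J k ?\<sigma>" using word_branch_J[OF assms(1) w x' wx] .
  \<comment> \<open>All \<open>m\<close> up to \<open>k\<close> are needed: each step through
    \<open>D0\<close> lowers the index of the cut by one.\<close>
  have R: "p m ?\<sigma> \<le> br ?\<sigma> D y" if m: "m \<le> k" "p m ?\<sigma> \<le> br ?\<sigma> D x" for m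
  proof (cases m)
    case 0
    then show ?thesis using m x' by simp
  next
    case (Suc j)
    show ?thesis
    proof (cases "D = D0")
      case False
      have "br ?\<sigma> D0 1 \<le> br ?\<sigma> D y" using f.branch_in[OF D] y by (intro f.branch0_one_le[OF D False]) auto
      moreover have "p m ?\<sigma> \<le> p 1 ?\<sigma>" using Suc by (intro p_antimono[OF \<sigma>]) simp
      ultimately show ?thesis by (simp add: inverse_branch_def)
    next
      case True
      have pj: "0 < p j (\<theta> ?\<sigma>)" "p j (\<theta> ?\<sigma>) \<le> 1" using p_pos p_bounds \<theta>_space[OF \<sigma>] by blast+
      \<comment> \<open>Otherwise monotonicity of the branch would force
        \<open>br ?\<sigma> D0 x\<close> to be the cut point itself, which \<open>p_notin_J\<close>
        forbids.\<close>
      have "p j (\<theta> ?\<sigma>) \<le> x"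
      proof (rule ccontr)
        assume n: "\<not> p j (\<theta> ?\<sigma>) \<le> x"
        then have "br ?\<sigma> D0 x \<le> p m ?\<sigma>" unfolding Suc p_Suc using x pj by (intro f.branch0_mono) auto
        then have "br ?\<sigma> D0 x = p m ?\<sigma>" using m True by simp
        then show False using x'J p_notin_J[OF \<sigma>, of m k] True by simp
      qed
      then have "p j (\<theta> ?\<sigma>) \<le> y" using Cons.prems(4)[of j] m Suc by simp
      then show ?thesis unfolding Suc p_Suc True using y pj by (intro f.branch0_mono) auto
    qed
  qed
  have "p k ?\<sigma> \<le> br ?\<sigma> D x" using x'J J_iff by blast
  then have "p k' ?\<sigma> \<le> br ?\<sigma> D y" using R[of k] p_antimono[OF \<sigma> assms(2)] by auto
  then have "br ?\<sigma> D y \<in> J k' ?\<sigma>" using br_in_J_iff[OF \<sigma> D yJ] by simp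
  then show ?case using Cons.IH[OF w x'J _ _ wx] R by simp
qed

text \<open>\<open>B\<close> compares the two exponents on the range of derivatives of the
  \<open>n\<close>-th iterate, the square of \<open>2 / \<epsilon> k\<close> is the distortion
  constant, and \<open>A powr t'\<close> pays for the extra step that produces
  \<open>Suc n\<close>.\<close>

lemma iter_compare:
  assumes "\<omega> \<in> space M" "k \<le> k'" "1 \<le> k'" "0 \<le> t'" "0 \<le> B"
    and B: "\<And>d. (\<epsilon> k / 4)\<^sup>2 \<le> d \<Longrightarrow> d \<le> A ^ n \<Longrightarrow> d powr (- t) \<le> B * d powr (- t')"
    and xJ: "x \<in> J k ((\<theta> ^^ n) \<omega>)" and yJ: "y \<in> J k' ((\<theta> ^^ Suc n) \<omega>)"
  shows "iter t k n \<omega> x \<le> B * ((2 / \<epsilon> k)\<^sup>2) powr t' * A powr t' * iter t' k' (Suc n) \<omega> y"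
proof -
  let ?\<sigma> = "(\<theta> ^^ n) \<omega>"
  have \<sigma>: "?\<sigma> \<in> space M" using \<theta>n_space assms(1) .
  \<comment> \<open>The extra step: \<open>z\<close> lies to the right of
    \<open>p 1 ?\<sigma>\<close> wherever \<open>y\<close> is, as \<open>word_admissible\<close>
    requires.\<close>
  define z where "z = br ?\<sigma> D1 y"
  define K where "K = (2 / \<epsilon> k)\<^sup>2"
  have K: "0 < K" using \<epsilon>_pos[of k] by (simp add: K_def)
  have zJ: "z \<in> J k' ?\<sigma>" and z1: "p 1 ?\<sigma> \<le> z"
    using D1_branch_in_J[OF \<sigma> assms(3)] yJ by (simp_all add: z_def)
  note x = J_bounds[OF \<sigma> xJ] and z = J_bounds[OF \<sigma> zJ]
  \<comment> \<open>For \<open>m = 0\<close> the premise fails, as \<open>p 0\<close> is 1 and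
    \<open>x < 1\<close>; every other cut is at most \<open>p 1 ?\<sigma>\<close>.\<close>
  have R: "p m ?\<sigma> \<le> z" if "m \<le> k" "p m ?\<sigma> \<le> x" for m
  proof (cases m)
    case 0
    then show ?thesis using that x by simp
  next
    case (Suc j)
    then show ?thesis using p_antimono[OF \<sigma>, of 1 m] z1 by simp
  qed
  have "iter t k n \<omega> x \<le> (\<Sum>w\<in>words n. B * K powr t' *
      (if word_branch \<omega> w z \<in> J k' \<omega> then (word_weight \<omega> w z)\<^sup>2 powr (- t') else 0))"
    unfolding iter_eq[OF assms(1) xJ]
  proof (rule sum_mono)
    fix w assume "w \<in> words n"
    then have w: "set w \<subseteq> G" "length w = n" by (auto simp: words_def)
    define d where "d = (word_weight \<omega> w x)\<^sup>2"
    note cb = concave_branch_word[OF assms(1) w(1)]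
    have px: "0 < word_weight \<omega> w x" and pz: "0 < word_weight \<omega> w z"
      using concave_branchD(3)[OF cb] x z by auto
    show "(if word_branch \<omega> w x \<in> J k \<omega> then (word_weight \<omega> w x)\<^sup>2 powr (- t) else 0)
       \<le> B * K powr t' * (if word_branch \<omega> w z \<in> J k' \<omega> then (word_weight \<omega> w z)\<^sup>2 powr (- t') else 0)"
    proof (cases "word_branch \<omega> w x \<in> J k \<omega>")
      case False
      then show ?thesis using assms(5) by simp
    next
      case True
      have adm: "word_branch \<omega> w z \<in> J k' \<omega>"
        using word_admissible[OF assms(1,2) w(1), of x z] xJ zJ R True w(2) by simp
      have "\<epsilon> k / 4 \<le> word_weight \<omega> w x" using word_weight_ge[OF assms(1) w(1), of x k] xJ w(2) by simp
      then have d1: "(\<epsilon> k / 4)\<^sup>2 \<le> d" unfolding d_def using \<epsilon>_pos[of k] by (intro power_mono) auto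
      have d2: "d \<le> A ^ n" using word_weight_le[OF assms(1) w(1) x(3,4)] w(2) by (simp add: d_def)
      \<comment> \<open>Distortion is used in the direction whose constant depends on the position
        of \<open>x\<close> alone. \<open>z\<close> may be much closer to 0 or 1, so this keeps
        \<open>k'\<close> out of the constant.\<close>
      have "\<epsilon> k / 2 * word_weight \<omega> w z \<le> min x (1 - x) / 2 * word_weight \<omega> w z"
        using x pz by (intro mult_right_mono) auto
      also have "\<dots> \<le> word_weight \<omega> w x" using concave_branch_distortion[OF cb] x z by simp
      finally have "word_weight \<omega> w z \<le> 2 / \<epsilon> k * word_weight \<omega> w x"
        using \<epsilon>_pos[of k] by (simp add: pos_le_divide_eq mult.commute)
      then have "(word_weight \<omega> w z)\<^sup>2 \<le> (2 / \<epsilon> k * word_weight \<omega> w x)\<^sup>2"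
        using pz by (intro power_mono) auto
      then have "(word_weight \<omega> w z)\<^sup>2 \<le> K * d" by (simp only: K_def d_def power_mult_distrib)
      then have "(K * d) powr (- t') \<le> (word_weight \<omega> w z)\<^sup>2 powr (- t')"
        using pz assms(4) by (intro powr_mono2') auto
      then have "K powr t' * (K powr (- t') * d powr (- t')) \<le> K powr t' * (word_weight \<omega> w z)\<^sup>2 powr (- t')"
        using K px by (intro mult_left_mono) (auto simp: powr_mult d_def)
      moreover have "K powr t' * (K powr (- t') * d powr (- t')) = d powr (- t')"
        using K by (simp add: powr_minus flip: mult.assoc)
      ultimately have "d powr (- t') \<le> K powr t' * (word_weight \<omega> w z)\<^sup>2 powr (- t')" by simp
      then have "B * d powr (- t') \<le> B * (K powr t' * (word_weight \<omega> w z)\<^sup>2 powr (- t'))"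
        using assms(5) by (rule mult_left_mono)
      with B[OF d1 d2] show ?thesis using True adm by (simp add: d_def mult.assoc)
    qed
  qed
  also have "\<dots> = B * K powr t' * iter t' k' n \<omega> z"
    unfolding iter_eq[OF assms(1) zJ] by (simp add: sum_distrib_left)
  also have "\<dots> \<le> B * K powr t' * (A powr t' * iter t' k' (Suc n) \<omega> y)"
  proof (rule mult_left_mono)
    have "A powr t' * (A powr (- t') * iter t' k' n \<omega> z) \<le> A powr t' * iter t' k' (Suc n) \<omega> y"
      using iter_Suc_ge[OF assms(1,3,4) yJ] A_gt_1 by (intro mult_left_mono) (auto simp: z_def)
    then show "iter t' k' n \<omega> z \<le> A powr t' * iter t' k' (Suc n) \<omega> y"
      using A_gt_1 by (simp add: powr_minus flip: mult.assoc)
  qed (use assms(5) in auto)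
  finally show ?thesis by (simp add: K_def mult.assoc)
qed

end

section \<open>Comparison of pressures\<close>

locale conformal_system = random_system M \<theta> T GC GE D0 D1 \<kappa> A \<gamma> c v
  for M :: "'w measure" and \<theta> T GC GE D0 D1 \<kappa> A \<gamma> c v +
  fixes N :: "real \<Rightarrow> nat \<Rightarrow> ('w \<times> real) measure"
    and \<nu> :: "real \<Rightarrow> nat \<Rightarrow> 'w \<Rightarrow> real measure"
    and \<Lambda> :: "real \<Rightarrow> nat \<Rightarrow> 'w \<Rightarrow> real"
  assumes conf: "\<And>t k. 0 \<le> t \<Longrightarrow> 1 \<le> k \<Longrightarrow>
    conformal M \<theta> T (GC \<union> GE) D0 t k (N t k) (\<nu> t k) (\<Lambda> t k)"
begin

text \<open>The quantifier over \<open>g\<close> is inside the condition on \<open>\<omega>\<close>,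
  because the functions to be inserted, the iterates, depend on \<open>\<omega>\<close>
  themselves.\<close>

definition conformal_orbit :: "real \<Rightarrow> nat \<Rightarrow> 'w \<Rightarrow> bool" where
  "conformal_orbit t k \<omega> \<longleftrightarrow> \<omega> \<in> space M \<and> (\<forall>n. measure (\<nu> t k ((\<theta> ^^ n) \<omega>)) (J k ((\<theta> ^^ n) \<omega>)) = 1 \<and>
    (\<forall>g. continuous_on (J k ((\<theta> ^^ n) \<omega>)) g \<longrightarrow>
        (LINT x:J k (\<theta> ((\<theta> ^^ n) \<omega>))|\<nu> t k (\<theta> ((\<theta> ^^ n) \<omega>)). transfer_op \<theta> T G D0 t k ((\<theta> ^^ n) \<omega>) g x)
        = \<Lambda> t k ((\<theta> ^^ n) \<omega>) * (LINT x:J k ((\<theta> ^^ n) \<omega>)|\<nu> t k ((\<theta> ^^ n) \<omega>). g x)))"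

section \<open>Conformal measures along almost every orbit\<close>

lemma \<Lambda>_pos: "0 \<le> t \<Longrightarrow> 1 \<le> k \<Longrightarrow> \<omega> \<in> space M \<Longrightarrow> 0 < \<Lambda> t k \<omega>"
  using conf[of t k] by (simp add: conformal_def)

lemma \<Lambda>_measurable: "0 \<le> t \<Longrightarrow> 1 \<le> k \<Longrightarrow> \<Lambda> t k \<in> borel_measurable M"
  using conf[of t k] by (simp add: conformal_def)

lemma \<nu>_prob:
  assumes "0 \<le> t" "1 \<le> k" "\<omega> \<in> space M"
  shows "prob_space (\<nu> t k \<omega>)" "sets (\<nu> t k \<omega>) = sets unit_borel" "space (\<nu> t k \<omega>) = {0..1}"
proof -
  have "\<nu> t k \<in> measurable M (prob_algebra unit_borel)"
    using conf[OF assms(1,2)] by (simp add: conformal_def disintegration_def)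
  from measurable_space[OF this assms(3)]
  show "prob_space (\<nu> t k \<omega>)" and 1: "sets (\<nu> t k \<omega>) = sets unit_borel"
    by (simp_all add: space_prob_algebra)
  show "space (\<nu> t k \<omega>) = {0..1}"
    using sets_eq_imp_space_eq[OF 1] by (simp add: space_restrict_space)
qed

lemma J_sets:
  assumes "0 \<le> t" "1 \<le> k" "\<omega> \<in> space M"
  shows "J k \<omega> \<in> sets (\<nu> t k \<omega>)"
proof -
  have "J k \<omega> \<subseteq> {0..1}" using J_bounds(3,4)[OF assms(3)] by (force intro: less_imp_le)
  then show ?thesis unfolding \<nu>_prob(2)[OF assms]
    by (subst sets_restrict_space_iff) (use closed_J[OF assms(3)] in auto)
qed

text \<open>The support condition is stated for \<open>N t k\<close> and is passed to the fibre
  measures by disintegration. Measurability of the whole bundle of fibres is avoided by slicing a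
  measurable null set \<open>Z\<close> that covers its complement.\<close>

lemma AE_measure_J:
  assumes "0 \<le> t" "1 \<le> k"
  shows "AE \<omega> in M. measure (\<nu> t k \<omega>) (J k \<omega>) = 1"
proof -
  let ?N = "N t k" and ?\<nu> = "\<nu> t k"
  have sN: "sets ?N = sets (M \<Otimes>\<^sub>M unit_borel)"
    and dis: "\<And>B. B \<in> sets (M \<Otimes>\<^sub>M unit_borel) \<Longrightarrow> emeasure ?N B = (\<integral>\<^sup>+\<omega>. emeasure (?\<nu> \<omega>) (Pair \<omega> -` B) \<partial>M)"
    and m: "?\<nu> \<in> measurable M (prob_algebra unit_borel)"
    and ae: "AE z in ?N. z \<in> (SIGMA \<omega>:space M. J k \<omega>)"
    using conf[OF assms] by (simp_all add: conformal_def random_prob_measure_def disintegration_def)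
  obtain Z where Z: "{z \<in> space ?N. z \<notin> (SIGMA \<omega>:space M. J k \<omega>)} \<subseteq> Z" "emeasure ?N Z = 0" "Z \<in> sets ?N"
    using AE_E[OF ae] by blast
  have sp: "space ?N = space M \<times> {0..1}"
    using sets_eq_imp_space_eq[OF sN] by (simp add: space_pair_measure space_restrict_space)
  have Zs: "Z \<in> sets (M \<Otimes>\<^sub>M unit_borel)" using Z(3) sN by simp
  have ZS: "(SIGMA \<omega>:space M. Pair \<omega> -` Z) = Z"
    using sets.sets_into_space[OF Z(3)] sp by auto
  have "(\<lambda>\<omega>. emeasure (?\<nu> \<omega>) (Pair \<omega> -` Z)) \<in> borel_measurable M"
    by (rule emeasure_measurable_subprob_algebra2[OF _ measurable_prob_algebraD[OF m]]) (simp add: ZS Zs)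
  then have "AE \<omega> in M. emeasure (?\<nu> \<omega>) (Pair \<omega> -` Z) = 0"
    using dis[OF Zs] Z(2) by (simp add: nn_integral_0_iff_AE)
  from this AE_space show ?thesis
  proof eventually_elim
    case (elim \<omega>)
    note \<omega> = \<nu>_prob[OF assms elim(2)]
    interpret P: prob_space "?\<nu> \<omega>" using \<omega>(1) .
    have js: "J k \<omega> \<in> sets (?\<nu> \<omega>)" using J_sets[OF assms elim(2)] .
    have "space (?\<nu> \<omega>) - J k \<omega> \<subseteq> Pair \<omega> -` Z"
      using Z(1) sp elim(2) \<omega>(3) by auto
    moreover have "Pair \<omega> -` Z \<in> sets (?\<nu> \<omega>)" using sets_Pair1[OF Zs] \<omega>(2) by simp
    ultimately have "emeasure (?\<nu> \<omega>) (space (?\<nu> \<omega>) - J k \<omega>) \<le> 0"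
      using emeasure_mono elim(1) by metis
    then have "P.prob (space (?\<nu> \<omega>) - J k \<omega>) = 0" by (simp add: measure_def)
    then show ?case using P.prob_compl[OF js] by simp
  qed
qed

text \<open>Preimages of null sets under the measure-preserving \<open>\<theta>\<close> are null,
  and only countably many occur.\<close>

lemma AE_orbit:
  assumes "AE \<omega> in M. P \<omega>"
  shows "AE \<omega> in M. \<forall>n. P ((\<theta> ^^ n) \<omega>)"
proof -
  have "AE \<omega> in M. P ((\<theta> ^^ n) \<omega>)" for n
  proof (induction n)
    case (Suc n)
    then have "AE \<omega> in distr M M \<theta>. P ((\<theta> ^^ n) \<omega>)" unfolding \<theta>_distr .
    from AE_distrD[OF \<theta>_measurable this] show ?case by (simp add: funpow_swap1)
  qed (use assms in simp)
  then show ?thesis by (simp add: AE_all_countable)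
qed

lemma AE_conformal_orbit:
  assumes "0 \<le> t" "1 \<le> k"
  shows "AE \<omega> in M. conformal_orbit t k \<omega>"
proof -
  have "AE \<omega> in M. \<forall>g. continuous_on (J k \<omega>) g \<longrightarrow>
        (LINT x:J k (\<theta> \<omega>)|\<nu> t k (\<theta> \<omega>). transfer_op \<theta> T G D0 t k \<omega> g x)
        = \<Lambda> t k \<omega> * (LINT x:J k \<omega>|\<nu> t k \<omega>. g x)"
    using conf[OF assms] by (simp add: conformal_def)
  from AE_orbit[OF this] AE_orbit[OF AE_measure_J[OF assms]] AE_space show ?thesis
    unfolding conformal_orbit_def by eventually_elim blast
qed

text \<open>Duality applied to the continuous iterate peels off one eigenvalue at a time; the base
  case is the full measure of the fibre.\<close>

lemma integral_iter:
  assumes "conformal_orbit t k \<omega>"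
  shows "(LINT x:J k ((\<theta> ^^ n) \<omega>)|\<nu> t k ((\<theta> ^^ n) \<omega>). iter t k n \<omega> x) = (\<Prod>j<n. \<Lambda> t k ((\<theta> ^^ j) \<omega>))"
proof (induction n)
  case 0
  have "measure (\<nu> t k \<omega>) (J k \<omega>) = 1" using assms unfolding conformal_orbit_def by (metis funpow_0)
  moreover from this have "J k \<omega> \<in> sets (\<nu> t k \<omega>)" by (metis measure_notin_sets zero_neq_one)
  ultimately show ?case using sets.sets_into_space by (simp add: set_lebesgue_integral_def Int_absorb2)
next
  case (Suc n)
  have \<omega>: "\<omega> \<in> space M" using assms unfolding conformal_orbit_def by blast
  have "(LINT x:J k (\<theta> ((\<theta> ^^ n) \<omega>))|\<nu> t k (\<theta> ((\<theta> ^^ n) \<omega>)). transfer_op \<theta> T G D0 t k ((\<theta> ^^ n) \<omega>) (iter t k n \<omega>) x)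
        = \<Lambda> t k ((\<theta> ^^ n) \<omega>) * (LINT x:J k ((\<theta> ^^ n) \<omega>)|\<nu> t k ((\<theta> ^^ n) \<omega>). iter t k n \<omega> x)"
    using assms continuous_iter[OF \<omega>] unfolding conformal_orbit_def by blast
  then show ?case by (simp add: Suc.IH mult.commute)
qed

section \<open>Products of eigenvalues as averages of iterates\<close>

lemma prod_\<Lambda>_pos:
  assumes "0 \<le> t" "1 \<le> k" "\<omega> \<in> space M"
  shows "0 < (\<Prod>j<n. \<Lambda> t k ((\<theta> ^^ j) \<omega>))"
  by (intro prod_pos) (use \<Lambda>_pos[OF assms(1,2)] \<theta>n_space[OF assms(3)] in auto)

lemma prod_\<Lambda>_bounds:
  assumes "0 \<le> t" "1 \<le> k" "conformal_orbit t k \<omega>"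
  shows "(\<And>x. x \<in> J k ((\<theta> ^^ n) \<omega>) \<Longrightarrow> iter t k n \<omega> x \<le> C) \<Longrightarrow> (\<Prod>j<n. \<Lambda> t k ((\<theta> ^^ j) \<omega>)) \<le> C"
    and "(\<And>x. x \<in> J k ((\<theta> ^^ n) \<omega>) \<Longrightarrow> C \<le> iter t k n \<omega> x) \<Longrightarrow> C \<le> (\<Prod>j<n. \<Lambda> t k ((\<theta> ^^ j) \<omega>))"
proof -
  let ?\<sigma> = "(\<theta> ^^ n) \<omega>"
  let ?I = "indicator (J k ?\<sigma>) :: real \<Rightarrow> real"
  have \<omega>: "\<omega> \<in> space M" and m1: "measure (\<nu> t k ?\<sigma>) (J k ?\<sigma>) = 1"
    using assms(3) unfolding conformal_orbit_def by blast+
  note \<sigma> = \<theta>n_space[OF \<omega>, of n]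
  interpret P: prob_space "\<nu> t k ?\<sigma>" using \<nu>_prob(1)[OF assms(1,2) \<sigma>] .
  have js: "J k ?\<sigma> \<in> sets (\<nu> t k ?\<sigma>)" using J_sets[OF assms(1,2) \<sigma>] .
  have eq: "(\<integral>x. ?I x * iter t k n \<omega> x \<partial>\<nu> t k ?\<sigma>) = (\<Prod>j<n. \<Lambda> t k ((\<theta> ^^ j) \<omega>))"
    using integral_iter[OF assms(3), of n] by (simp add: set_lebesgue_integral_def)
  \<comment> \<open>A non-integrable function has integral 0 by convention, whereas this integral is
    a positive product.\<close>
  have int: "integrable (\<nu> t k ?\<sigma>) (\<lambda>x. ?I x * iter t k n \<omega> x)"
  proof (rule ccontr)
    assume "\<not> ?thesis"
    from not_integrable_integral_eq[OF this] show False
      using eq prod_\<Lambda>_pos[OF assms(1,2) \<omega>, of n] by linarith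
  qed
  have intC: "integrable (\<nu> t k ?\<sigma>) (\<lambda>x. ?I x * C)"
    using js by (simp add: less_top[symmetric])
  have eqC: "(\<integral>x. ?I x * C \<partial>\<nu> t k ?\<sigma>) = C"
    using js m1 sets.sets_into_space[OF js] by (simp add: Int_absorb2)
  show "(\<Prod>j<n. \<Lambda> t k ((\<theta> ^^ j) \<omega>)) \<le> C" if "\<And>x. x \<in> J k ?\<sigma> \<Longrightarrow> iter t k n \<omega> x \<le> C"
    unfolding eq[symmetric] by (subst eqC[symmetric], rule integral_mono[OF int intC])
      (use that in \<open>auto simp: indicator_def\<close>)
  show "C \<le> (\<Prod>j<n. \<Lambda> t k ((\<theta> ^^ j) \<omega>))" if "\<And>x. x \<in> J k ?\<sigma> \<Longrightarrow> C \<le> iter t k n \<omega> x"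
    unfolding eq[symmetric] by (subst eqC[symmetric], rule integral_mono[OF intC int])
      (use that in \<open>auto simp: indicator_def\<close>)
qed

text \<open>One step of the operator applied to 1 contains the \<open>D1\<close> term. At
  \<open>t = 0\<close> the bound is 1, which makes the pressure there nonnegative.\<close>

lemma \<Lambda>_ge:
  assumes "0 \<le> t" "1 \<le> k" "conformal_orbit t k \<omega>"
  shows "A powr (- t) \<le> \<Lambda> t k \<omega>"
proof -
  have \<omega>: "\<omega> \<in> space M" using assms(3) unfolding conformal_orbit_def by blast
  have "A powr (- t) \<le> (\<Prod>j<1. \<Lambda> t k ((\<theta> ^^ j) \<omega>))"
    by (rule prod_\<Lambda>_bounds(2)[OF assms]) (use iter_Suc_ge[OF \<omega> assms(2,1), of _ 0] in simp)
  then show ?thesis by simp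
qed

lemma \<Lambda>_le:
  assumes "0 \<le> t" "1 \<le> k" "conformal_orbit t k \<omega>"
  shows "\<Lambda> t k \<omega> \<le> real (card (words 1)) * ((\<epsilon> k / 4)\<^sup>2) powr (- t)"
proof -
  have \<omega>: "\<omega> \<in> space M" using assms(3) unfolding conformal_orbit_def by blast
  have "(\<Prod>j<1. \<Lambda> t k ((\<theta> ^^ j) \<omega>)) \<le> real (card (words 1)) * ((\<epsilon> k / 4)\<^sup>2) powr (- t)"
    by (rule prod_\<Lambda>_bounds(1)[OF assms]) (use iter_le[OF \<omega> _ assms(1), of _ k 1] in auto)
  then show ?thesis by simp
qed

lemma integrable_ln_\<Lambda>:
  assumes "0 \<le> t" "1 \<le> k"
  shows "integrable M (\<lambda>\<omega>. ln (\<Lambda> t k \<omega>))"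
proof -
  interpret prob_space M using prob .
  let ?u = "ln (A powr (- t))" and ?v = "ln (real (card (words 1)) * ((\<epsilon> k / 4)\<^sup>2) powr (- t))"
  have "AE \<omega> in M. norm (ln (\<Lambda> t k \<omega>)) \<le> max (- ?u) ?v"
    using AE_conformal_orbit[OF assms]
  proof eventually_elim
    case (elim \<omega>)
    have pos: "0 < \<Lambda> t k \<omega>" using elim \<Lambda>_pos[OF assms] unfolding conformal_orbit_def by blast
    have "?u \<le> ln (\<Lambda> t k \<omega>)" using \<Lambda>_ge[OF assms elim] A_gt_1 pos by (subst ln_le_cancel_iff) auto
    moreover have "ln (\<Lambda> t k \<omega>) \<le> ?v" using \<Lambda>_le[OF assms elim] pos by (subst ln_le_cancel_iff) auto
    ultimately show ?case by auto
  qed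
  then show ?thesis using \<Lambda>_measurable[OF assms] by (intro integrable_const_bound) auto
qed

section \<open>Integrated logarithms and comparison of pressures\<close>

lemma distr_\<theta>n: "distr M M (\<theta> ^^ n) = M"
proof (induction n)
  case (Suc n)
  have "distr M M (\<theta> ^^ Suc n) = distr (distr M M (\<theta> ^^ n)) M \<theta>"
    unfolding funpow.simps(2)
    using distr_distr[OF \<theta>_measurable measurable_compose_n[OF \<theta>_measurable]] by (rule sym)
  then show ?case by (simp only: Suc \<theta>_distr)
qed (simp add: id_def distr_id)

lemma integral_shift:
  assumes "integrable M f"
  shows "integrable M (\<lambda>\<omega>. f ((\<theta> ^^ n) \<omega>))" "(\<integral>\<omega>. f ((\<theta> ^^ n) \<omega>) \<partial>M) = (\<integral>\<omega>. (f \<omega> :: real) \<partial>M)"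
  using integrable_distr[OF measurable_compose_n[OF \<theta>_measurable, of n], of f]
    integral_distr[OF measurable_compose_n[OF \<theta>_measurable, of n], of f] assms
  by (simp_all add: distr_\<theta>n)

lemma integral_ln_prod:
  assumes "0 \<le> t" "1 \<le> k"
  shows "integrable M (\<lambda>\<omega>. \<Sum>j<n. ln (\<Lambda> t k ((\<theta> ^^ j) \<omega>)))"
    "(\<integral>\<omega>. (\<Sum>j<n. ln (\<Lambda> t k ((\<theta> ^^ j) \<omega>))) \<partial>M) = real n * EP M \<Lambda> k t"
  using integral_shift[OF integrable_ln_\<Lambda>[OF assms]] by (simp_all add: EP_def)

text \<open>Iterates of the operators with parameters \<^term>\<open>t\<close>, \<^term>\<open>k\<close> are compared with those for \<^term>\<open>t'\<close>, \<^term>\<open>k'\<close>. Since \<^term>\<open>C\<close> does not depend on their number \<open>n\<close>,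
  it disappears after integrating the logarithms and dividing by \<open>n\<close>.\<close>

lemma EP_compare:
  assumes "0 \<le> t" "0 \<le> t'" "1 \<le> k" "k \<le> k'" "1 \<le> b" "0 < C"
    and B: "\<And>n d. (\<epsilon> k / 4)\<^sup>2 \<le> d \<Longrightarrow> d \<le> A ^ n \<Longrightarrow> d powr (- t) \<le> C * b ^ n * d powr (- t')"
  shows "EP M \<Lambda> k t \<le> EP M \<Lambda> k' t' + ln b"
proof -
  interpret prob_space M using prob .
  have k': "1 \<le> k'" using assms by simp
  define K where "K = C * ((2 / \<epsilon> k)\<^sup>2) powr t' * A powr t'"
  have K: "0 < K" using assms(6) \<epsilon>_pos[of k] A_gt_1 by (simp add: K_def)
  have *: "real n * EP M \<Lambda> k t \<le> ln K + real n * ln b + real (Suc n) * EP M \<Lambda> k' t'" for n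
  proof -
    have "(\<integral>\<omega>. (\<Sum>j<n. ln (\<Lambda> t k ((\<theta> ^^ j) \<omega>))) \<partial>M) \<le>
      (\<integral>\<omega>. (ln K + real n * ln b) + (\<Sum>j<Suc n. ln (\<Lambda> t' k' ((\<theta> ^^ j) \<omega>))) \<partial>M)"
    proof (rule integral_mono_AE)
      show "integrable M (\<lambda>\<omega>. \<Sum>j<n. ln (\<Lambda> t k ((\<theta> ^^ j) \<omega>)))"
        using integral_ln_prod(1)[OF assms(1,3)] .
      show "integrable M (\<lambda>\<omega>. (ln K + real n * ln b) + (\<Sum>j<Suc n. ln (\<Lambda> t' k' ((\<theta> ^^ j) \<omega>))))"
        by (intro Bochner_Integration.integrable_add integrable_const integral_ln_prod(1)[OF assms(2) k'])
      show "AE \<omega> in M. (\<Sum>j<n. ln (\<Lambda> t k ((\<theta> ^^ j) \<omega>))) \<le>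
          (ln K + real n * ln b) + (\<Sum>j<Suc n. ln (\<Lambda> t' k' ((\<theta> ^^ j) \<omega>)))"
        using AE_conformal_orbit[OF assms(1,3)] AE_conformal_orbit[OF assms(2) k']
      proof eventually_elim
        case (elim \<omega>)
        have \<omega>: "\<omega> \<in> space M" using elim(1) unfolding conformal_orbit_def by blast
        define E E' where "E = (\<Prod>j<n. \<Lambda> t k ((\<theta> ^^ j) \<omega>))" and "E' = (\<Prod>j<Suc n. \<Lambda> t' k' ((\<theta> ^^ j) \<omega>))"
        have pos: "0 < E" "0 < E'"
          unfolding E_def E'_def using prod_\<Lambda>_pos[OF assms(1,3) \<omega>] prod_\<Lambda>_pos[OF assms(2) k' \<omega>] by blast+
        have Kb: "0 < K * b ^ n" using K assms(5) by simp
        \<comment> \<open>The pointwise comparison holds for all pairs \<open>x\<close>,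
          \<open>y\<close>. Averaging over \<open>x\<close> with \<open>y\<close> fixed gives this
          bound; averaging over \<open>y\<close> then replaces the other iterate by
          \<open>E'\<close>.\<close>
        have "E \<le> K * b ^ n * iter t' k' (Suc n) \<omega> y" if y: "y \<in> J k' ((\<theta> ^^ Suc n) \<omega>)" for y
          unfolding E_def
        proof (rule prod_\<Lambda>_bounds(1)[OF assms(1,3) elim(1)])
          show "iter t k n \<omega> x \<le> K * b ^ n * iter t' k' (Suc n) \<omega> y" if x: "x \<in> J k ((\<theta> ^^ n) \<omega>)" for x
          proof -
            have "iter t k n \<omega> x \<le> (C * b ^ n) * ((2 / \<epsilon> k)\<^sup>2) powr t' * A powr t' * iter t' k' (Suc n) \<omega> y"
              using assms(5,6) by (intro iter_compare[OF \<omega> assms(4) k' assms(2) _ B x y]) auto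
            then show ?thesis by (simp only: K_def mult_ac)
          qed
        qed
        then have "E / (K * b ^ n) \<le> E'"
          unfolding E'_def using Kb
          by (intro prod_\<Lambda>_bounds(2)[OF assms(2) k' elim(2)]) (simp only: pos_divide_le_eq mult.commute)
        then have "E \<le> K * b ^ n * E'" using Kb by (simp only: pos_divide_le_eq mult.commute)
        then have "ln E \<le> ln (K * b ^ n * E')" using pos Kb by (subst ln_le_cancel_iff) auto
        also have "\<dots> = ln K + real n * ln b + ln E'"
          using K pos assms(5) by (simp add: ln_mult ln_realpow)
        also have "ln E = (\<Sum>j<n. ln (\<Lambda> t k ((\<theta> ^^ j) \<omega>)))" unfolding E_def
          using \<Lambda>_pos[OF assms(1,3) \<theta>n_space[OF \<omega>]] by (intro ln_prod) (auto simp: less_imp_neq[symmetric])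
        also have "ln E' = (\<Sum>j<Suc n. ln (\<Lambda> t' k' ((\<theta> ^^ j) \<omega>)))" unfolding E'_def
          using \<Lambda>_pos[OF assms(2) k' \<theta>n_space[OF \<omega>]] by (intro ln_prod) (auto simp: less_imp_neq[symmetric])
        finally show ?case .
      qed
    qed
    also have "\<dots> = (ln K + real n * ln b) + real (Suc n) * EP M \<Lambda> k' t'"
      using integral_ln_prod[OF assms(2) k', of "Suc n"]
      by (subst Bochner_Integration.integral_add) (simp_all add: prob_space)
    finally show ?thesis using integral_ln_prod(2)[OF assms(1,3)] by simp
  qed
  \<comment> \<open>\<open>ln K\<close> and the one surplus \<open>EP M \<Lambda> k' t'\<close>
    caused by \<open>Suc n\<close> do not grow with \<open>n\<close>, so a positive gap per step is
    impossible.\<close>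
  show ?thesis
  proof (rule ccontr)
    assume "\<not> EP M \<Lambda> k t \<le> EP M \<Lambda> k' t' + ln b"
    then have "0 < EP M \<Lambda> k t - EP M \<Lambda> k' t' - ln b" by simp
    from reals_Archimedean3[OF this]
    obtain n where "ln K + EP M \<Lambda> k' t' < real n * (EP M \<Lambda> k t - EP M \<Lambda> k' t' - ln b)" by blast
    with *[of n] show False by (simp add: algebra_simps)
  qed
qed

text \<open>The ratio \<open>d powr (- (t - t'))\<close> is bounded through the lower bound on
  \<open>d\<close>, uniformly in \<open>n\<close>; hence the growth rate is
  \<open>b = 1\<close>.\<close>

lemma EP_mono:
  assumes "0 \<le> t'" "t' \<le> t" "1 \<le> k" "k \<le> k'"
  shows "EP M \<Lambda> k t \<le> EP M \<Lambda> k' t'"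
proof -
  have e: "0 < (\<epsilon> k / 4)\<^sup>2" using \<epsilon>_pos[of k] by simp
  have "EP M \<Lambda> k t \<le> EP M \<Lambda> k' t' + ln 1"
  proof (rule EP_compare)
    fix n d assume d: "(\<epsilon> k / 4)\<^sup>2 \<le> d"
    have "d powr (- t) = d powr (- (t - t')) * d powr (- t')" by (simp flip: powr_add)
    also have "\<dots> \<le> ((\<epsilon> k / 4)\<^sup>2) powr (- (t - t')) * d powr (- t')"
      using e d assms(2) by (intro mult_right_mono powr_mono2') auto
    finally show "d powr (- t) \<le> ((\<epsilon> k / 4)\<^sup>2) powr (- (t - t')) * 1 ^ n * d powr (- t')" by simp
  qed (use assms e in auto)
  then show ?thesis by simp
qed

text \<open>Here the upper bound \<open>d \<le> A ^ n\<close> is decisive: changing the exponent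
  costs at most \<open>A powr (t' - t)\<close> per step. This rate is free of \<open>k\<close> and
  so survives the limit.\<close>

lemma EP_lipschitz:
  assumes "0 \<le> t" "t \<le> t'" "1 \<le> k"
  shows "EP M \<Lambda> k t \<le> EP M \<Lambda> k t' + (t' - t) * ln A"
proof -
  have e: "0 < (\<epsilon> k / 4)\<^sup>2" using \<epsilon>_pos[of k] by simp
  have "EP M \<Lambda> k t \<le> EP M \<Lambda> k t' + ln (A powr (t' - t))"
  proof (rule EP_compare[where C = 1])
    fix n d assume d: "(\<epsilon> k / 4)\<^sup>2 \<le> d" "d \<le> A ^ n"
    have "d powr (- t) = d powr (t' - t) * d powr (- t')" by (simp flip: powr_add)
    also have "\<dots> \<le> (A ^ n) powr (t' - t) * d powr (- t')"
      using order_trans[OF less_imp_le[OF e] d(1)] d assms(2) by (intro mult_right_mono powr_mono2) auto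
    also have "(A ^ n) powr (t' - t) = (A powr (t' - t)) ^ n"
      using A_gt_1 by (simp add: powr_powr mult.commute flip: powr_realpow)
    finally show "d powr (- t) \<le> 1 * (A powr (t' - t)) ^ n * d powr (- t')" by simp
  qed (use assms A_gt_1 in \<open>auto intro: ge_one_powr_ge_zero\<close>)
  then show ?thesis using A_gt_1 by (simp add: ln_powr)
qed

lemma EP_0_nonneg:
  assumes "1 \<le> k"
  shows "0 \<le> EP M \<Lambda> k 0"
  unfolding EP_def
proof (rule integral_nonneg_AE)
  show "AE \<omega> in M. 0 \<le> ln (\<Lambda> 0 k \<omega>)"
    using AE_conformal_orbit[OF order_refl assms]
  proof eventually_elim
    case (elim \<omega>)
    then show ?case using \<Lambda>_ge[OF order_refl assms elim] A_gt_1 by simp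
  qed
qed

section \<open>The limit over truncation levels and its zero\<close>

lemma EP_inf_eq:
  assumes "0 \<le> t"
  shows "EP_inf M \<Lambda> t = (SUP k. ereal (EP M \<Lambda> (Suc k) t))"
proof -
  \<comment> \<open>Monotonicity is available from level 1 on, hence the shift; the term at 0 does
    not affect the limit.\<close>
  have "incseq (\<lambda>k. ereal (EP M \<Lambda> (Suc k) t))"
    using EP_mono[OF assms order_refl] by (auto simp: incseq_def)
  from LIMSEQ_SUP[OF this] have "(\<lambda>k. ereal (EP M \<Lambda> k t)) \<longlonglongrightarrow> (SUP k. ereal (EP M \<Lambda> (Suc k) t))"
    by (rule LIMSEQ_imp_Suc)
  then show ?thesis unfolding EP_inf_def by (rule limI)
qed

lemma EP_inf_antimono:
  assumes "0 \<le> t'" "t' \<le> t"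
  shows "EP_inf M \<Lambda> t \<le> EP_inf M \<Lambda> t'"
  unfolding EP_inf_eq[OF assms(1)] EP_inf_eq[OF order_trans[OF assms]]
proof (rule SUP_mono)
  show "\<exists>m\<in>UNIV. ereal (EP M \<Lambda> (Suc k) t) \<le> ereal (EP M \<Lambda> (Suc m) t')" for k
    using EP_mono[OF assms, of "Suc k" "Suc k"] by auto
qed

lemma EP_inf_lipschitz:
  assumes "0 \<le> t" "t \<le> t'"
  shows "EP_inf M \<Lambda> t \<le> EP_inf M \<Lambda> t' + ereal ((t' - t) * ln A)"
  unfolding EP_inf_eq[OF assms(1)]
proof (rule SUP_least)
  fix k
  have "ereal (EP M \<Lambda> (Suc k) t) \<le> ereal (EP M \<Lambda> (Suc k) t') + ereal ((t' - t) * ln A)"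
    using EP_lipschitz[OF assms, of "Suc k"] by simp
  also have "\<dots> \<le> EP_inf M \<Lambda> t' + ereal ((t' - t) * ln A)"
    unfolding EP_inf_eq[OF order_trans[OF assms]] by (intro add_mono SUP_upper) auto
  finally show "ereal (EP M \<Lambda> (Suc k) t) \<le> EP_inf M \<Lambda> t' + ereal ((t' - t) * ln A)" .
qed

lemma zero_in_D_set: "0 \<in> D_set M \<Lambda>"
proof -
  have "ereal (EP M \<Lambda> (Suc 0) 0) \<le> EP_inf M \<Lambda> 0"
    unfolding EP_inf_eq[OF order_refl] by (rule SUP_upper) simp
  then show ?thesis using EP_0_nonneg[of 1] unfolding D_set_def
    by (simp add: order_trans[of 0 "ereal (EP M \<Lambda> (Suc 0) 0)"])
qed

lemma EP_inf_at_b: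
  assumes fin: "b_sup M \<Lambda> < \<infinity>"
  defines "b \<equiv> enn2real (b_sup M \<Lambda>)"
  shows "EP_inf M \<Lambda> b = 0" "D_set M \<Lambda> = {0..b}"
proof -
  have b0: "0 \<le> b" by (simp add: b_def)
  have lnA: "0 < ln A" using A_gt_1 by simp
  have eb: "ennreal b = b_sup M \<Lambda>" using fin by (simp add: b_def)
  have le_b: "t \<le> b" if "t \<in> D_set M \<Lambda>" for t
  proof -
    have "ennreal t \<le> ennreal b" unfolding eb b_sup_def using that by (rule SUP_upper)
    then show ?thesis using b0 by (simp add: ennreal_le_iff)
  qed
  have approx: "\<exists>t\<in>D_set M \<Lambda>. b - \<delta> < t" if "0 < \<delta>" for \<delta>
  proof (rule ccontr)
    assume "\<not> ?thesis"
    then have n: "\<And>t. t \<in> D_set M \<Lambda> \<Longrightarrow> t \<le> b - \<delta>" by force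
    have "b_sup M \<Lambda> \<le> ennreal (b - \<delta>)" unfolding b_sup_def by (intro SUP_least ennreal_leI n)
    then have "ennreal b \<le> ennreal (b - \<delta>)" using eb by simp
    \<comment> \<open>\<open>ennreal\<close> sends negative numbers to 0, so the comparison below is
      reliable only once \<open>b - \<delta>\<close> is known to be nonnegative; membership of 0 in
      \<open>D_set M \<Lambda>\<close> provides this.\<close>
    moreover have "0 \<le> b - \<delta>" using n[OF zero_in_D_set] .
    ultimately show False using that by (simp add: ennreal_le_iff)
  qed
  have "0 \<le> EP_inf M \<Lambda> b"
  proof (rule ccontr)
    assume "\<not> ?thesis"
    then obtain r where r: "EP_inf M \<Lambda> b < ereal r" "ereal r < 0"
      using ereal_dense2[of "EP_inf M \<Lambda> b" 0] by (auto simp: not_le)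
    \<comment> \<open>At slope at least \<open>- ln A\<close>, the pressure loses at most
      \<open>- r\<close> over this length. From a nonnegative value just left of \<open>b\<close> it
      cannot fall below \<open>r\<close>.\<close>
    define \<delta> where "\<delta> = - r / ln A"
    have "0 < \<delta>" using r lnA by (simp add: \<delta>_def divide_neg_pos)
    from approx[OF this] obtain t where t: "t \<in> D_set M \<Lambda>" "b - \<delta> < t" by blast
    have "(b - t) * ln A \<le> \<delta> * ln A" using t lnA by (intro mult_right_mono) auto
    then have d: "(b - t) * ln A \<le> - r" using lnA by (simp add: \<delta>_def)
    have "0 \<le> EP_inf M \<Lambda> t" "0 \<le> t" using t by (simp_all add: D_set_def)
    note this(1)
    also have "EP_inf M \<Lambda> t \<le> EP_inf M \<Lambda> b + ereal ((b - t) * ln A)"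
      using EP_inf_lipschitz[OF \<open>0 \<le> t\<close> le_b[OF t(1)]] .
    also have "\<dots> \<le> EP_inf M \<Lambda> b + ereal (- r)" using d by (intro add_left_mono) simp
    also have "\<dots> < ereal r + ereal (- r)" using r by (cases "EP_inf M \<Lambda> b") auto
    finally show False by simp
  qed
  moreover have "EP_inf M \<Lambda> b \<le> 0"
  proof (rule ccontr)
    assume "\<not> ?thesis"
    then obtain r where r: "0 < ereal r" "ereal r < EP_inf M \<Lambda> b"
      using ereal_dense2[of 0 "EP_inf M \<Lambda> b"] by (auto simp: not_le)
    \<comment> \<open>Just as far to the right of \<open>b\<close> the loss is at most
      \<open>r\<close>, while the pressure there must already be negative. The argument also covers
      an infinite value at \<open>b\<close>.\<close>
    define t where "t = b + r / ln A"
    have t: "b < t" "(t - b) * ln A = r" using r lnA by (auto simp: t_def)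
    then have "t \<notin> D_set M \<Lambda>" using le_b by force
    then have "EP_inf M \<Lambda> t < 0" using t b0 by (simp add: D_set_def not_le)
    have "EP_inf M \<Lambda> b \<le> EP_inf M \<Lambda> t + ereal r"
      using EP_inf_lipschitz[OF b0, of t] t by simp
    also have "\<dots> \<le> 0 + ereal r" using \<open>EP_inf M \<Lambda> t < 0\<close> by (intro add_right_mono) simp
    finally show False using r by simp
  qed
  ultimately show eq: "EP_inf M \<Lambda> b = 0" by (rule antisym[rotated])
  show "D_set M \<Lambda> = {0..b}"
  proof (intro set_eqI iffI)
    fix t assume "t \<in> D_set M \<Lambda>"
    then show "t \<in> {0..b}" using le_b by (simp add: D_set_def)
  next
    fix t assume "t \<in> {0..b}"
    then show "t \<in> D_set M \<Lambda>" using EP_inf_antimono[of t b] eq by (simp add: D_set_def)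
  qed
qed

end

theorem corollary10p4:
  fixes M :: "'w measure" and \<theta> :: "'w \<Rightarrow> 'w" and T :: "'w \<Rightarrow> real \<Rightarrow> real"
    and GC GE :: "real set set" and D0 D1 :: "real set" and \<kappa> A :: real
    and \<gamma> :: "real set \<Rightarrow> nat" and c v :: "real set \<Rightarrow> real"
    and N :: "real \<Rightarrow> nat \<Rightarrow> ('w \<times> real) measure"
    and \<nu> :: "real \<Rightarrow> nat \<Rightarrow> 'w \<Rightarrow> real measure"
    and \<Lambda> :: "real \<Rightarrow> nat \<Rightarrow> 'w \<Rightarrow> real"
  assumes "random_critically_finite_map M \<theta> T GC GE D0 D1 \<kappa> A \<gamma> c v"
    and "\<And>t k. 0 \<le> t \<Longrightarrow> 1 \<le> k \<Longrightarrow>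
           conformal M \<theta> T (GC \<union> GE) D0 t k (N t k) (\<nu> t k) (\<Lambda> t k)"
    and "b_sup M \<Lambda> < \<infinity>"
  shows "EP_inf M \<Lambda> (enn2real (b_sup M \<Lambda>)) = 0
       \<and> D_set M \<Lambda> = {0..enn2real (b_sup M \<Lambda>)}"
proof -
  interpret conformal_system M \<theta> T GC GE D0 D1 \<kappa> A \<gamma> c v N \<nu> \<Lambda>
    using assms(1,2) by unfold_locales
  show ?thesis using EP_inf_at_b[OF assms(3)] by blast
qed

end
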